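(* Let $U\subset\mathbb{R}^2$ be open and $f,n:U\to\mathbb{R}$ smooth such that the surface $F=(u,v,f)$ is infinitesimally flexible with velocity diagram $V=(-v,u,n)$, i.e. $f_{uu}n_{vv}-2f_{uv}n_{uv}+f_{vv}n_{uu}=0$; assume $f_{uu}f_{vv}-f_{uv}^2\neq0$ and $n_{uu}n_{vv}-n_{uv}^2\ne0$ on $U$. Let $c$ satisfy $c_u=f_un_{uv}-f_vn_{uu}$, $c_v=f_un_{vv}-f_vn_{uv}$, and set $$C=(-n_u,-n_v,c),\quad \bar C=(-n_v,n_u,n_uu+n_vv-n),$$ $$B=(f_u,f_v,f_uu+f_vv-f),\quad \bar B=(f_v,-f_u,-n_uf_v+n_vf_u-c).$$ Then: (i) The rotation diagram $C$ and the translation diagram $\bar C$ of $(F,V)$ again form a pair of infinitesimally flexible surfaces, each being a velocity diagram of the other. (ii) The process that repeatedly replaces a pair (surface, velocity diagram) by the pair (translation diagram, rotation diagram) of that pair returns to $(F,V)$: with suitable choice of the additive constants in the rotation diagrams, one obtains $$(F,V)\to(\bar C,C)\to(\bar B,B)\to(F,V).$$ This closed sequence is called the (isotropic) Darboux wreath. (iii) The Darboux wreath consists of the six surfaces $F,V,C,\bar C,B,\bar B$. (iv) Each of the three pairs $(V,F)$, $(C,\bar C)$, $(B,\bar B)$ consists of infinitesimally flexible surfaces together with a corresponding velocity diagram, and the two surfaces of each pair are I-orthogonally related. (v) The three pairs $(V,\bar C)$, $(F,B)$, $(C,\bar B)$ are related by the metric duality $\delta$. (vi) Each of the three pairs $(F,C)$,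 $(\bar C,B)$, $(\bar B,V)$ has parallel tangent planes at corresponding points after the second surface of the pair is rotated by $\pi/2$ around the $z$-axis, i.e. replaced by its image under $J(x,y,z)=(-y,x,z)$.
   Context: The top view of $(x,y,z)\in\mathbb{R}^3$ is $(x,y)$; $\tilde X$ denotes the top view of a parametrized surface $X$. An admissible surface is a regular parametrized surface without tangent planes parallel to the $z$-axis (equivalently its top view is an immersion into $\mathbb{R}^2$). Locally it is a graph $z=\varphi(x,y)$ with isotropic Gaussian curvature $K=\varphi_{xx}\varphi_{yy}-\varphi_{xy}^2$. Points with the same parameter $(u,v)$ correspond. Velocity diagram: $Y(u,v)$ is a velocity diagram of (an infinitesimal isometry of) the admissible surface $X(u,v)$, and $X$ is infinitesimally flexible, if for $X^t=X+tY$ the $t$-derivatives at $t=0$ of $\langle\tilde X^t_u,\tilde X^t_u\rangle$, $\langle\tilde X^t_u,\tilde X^t_v\rangle$, $\langle\tilde X^t_v,\tilde X^t_v\rangle$ and of $K(X^t)$ vanish everywhere. Contact elements: $(x,y,z,p,q)$ is the point $(x,y,z)$ with the plane through it with Euclidean normal $(p,q,-1)$. Rotation and translation diagrams: let $X$ be an admissible surface with contact elements $(x,y,z,p,q)$ (functions of the parameters) and let $Y=(-y,x,y_3)$ be a velocity diagram of $X$. Write $dy_3=a\,dx+b\,dy$. The translation diagram of $(X,Y)$ is $(-b,\,a,\,-y_3+ax+by)$, and a rotation diagram of $(X,Y)$ is $(-a,-b,s)$ where $ds=-q\,da+p\,db$ (so $s$ is determined up to an additive constant). For $X=(u,v,f)$,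 $Y=(-v,u,n)$ these are $\bar C=(-n_v,n_u,n_uu+n_vv-n)$ and $C=(-n_u,-n_v,c)$ with $c_u=f_un_{uv}-f_vn_{uu}$, $c_v=f_un_{vv}-f_vn_{uv}$. I-orthogonally related: $\langle\tilde X_u,\tilde Y_u\rangle=\langle\tilde X_v,\tilde Y_v\rangle=\langle\tilde X_u,\tilde Y_v\rangle+\langle\tilde X_v,\tilde Y_u\rangle=0$. Metric duality $\delta$: point $(a,b,w)\leftrightarrow$ plane $ax+by-z-w=0$; on contact elements $\delta(x,y,z,p,q)=(p,q,px+qy-z,x,y)$. Two surfaces are related by $\delta$ if $\delta$ maps contact elements of one to those of the other at equal parameters. *)

theory Defs
  imports "HOL-Analysis.Analysis"
begin

type_synonym plane_point = "real \<times> real"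
type_synonym space_point = "real \<times> real \<times> real"
type_synonym surface = "plane_point \<Rightarrow> space_point"

text \<open>Functions and surfaces are total; only their values on the open parameter domain matter.\<close>

primrec Ck_on :: "nat \<Rightarrow> 'a::real_normed_vector set \<Rightarrow> ('a \<Rightarrow> 'b::real_normed_vector) \<Rightarrow> bool" where
  "Ck_on 0 S = (\<lambda>g. continuous_on S g)"
| "Ck_on (Suc k) S =
     (\<lambda>g. (\<forall>m\<in>S. g differentiable at m) \<and> (\<forall>w. Ck_on k S (\<lambda>m. frechet_derivative g (at m) w)))"

definition smooth_on :: "'a::real_normed_vector set \<Rightarrow> ('a \<Rightarrow> 'b::real_normed_vector) \<Rightarrow> bool" where
  "smooth_on S g \<longleftrightarrow> (\<forall>k. Ck_on k S g)"

definition Du :: "(plane_point \<Rightarrow> 'b::real_normed_vector) \<Rightarrow> plane_point \<Rightarrow> 'b" where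
  "Du g m = frechet_derivative g (at m) (1, 0)"

definition Dv :: "(plane_point \<Rightarrow> 'b::real_normed_vector) \<Rightarrow> plane_point \<Rightarrow> 'b" where
  "Dv g m = frechet_derivative g (at m) (0, 1)"

fun top_view :: "space_point \<Rightarrow> plane_point" where
  "top_view (x, y, z) = (x, y)"

definition xc :: "surface \<Rightarrow> plane_point \<Rightarrow> real" where "xc X m = fst (X m)"
definition yc :: "surface \<Rightarrow> plane_point \<Rightarrow> real" where "yc X m = fst (snd (X m))"
definition zc :: "surface \<Rightarrow> plane_point \<Rightarrow> real" where "zc X m = snd (snd (X m))"

definition tangent_space :: "surface \<Rightarrow> plane_point \<Rightarrow> space_point set" where
  "tangent_space X m = range (frechet_derivative X (at m))"

definition admissible :: "plane_point set \<Rightarrow> surface \<Rightarrow> bool" where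
  "admissible U X \<longleftrightarrow> open U \<and> smooth_on U X \<and>
     (\<forall>m\<in>U. inj (frechet_derivative X (at m)) \<and> (0, 0, 1) \<notin> tangent_space X m)"

definition local_graph :: "surface \<Rightarrow> plane_point \<Rightarrow> (plane_point \<Rightarrow> real) \<Rightarrow> bool" where
  "local_graph X m \<phi> \<longleftrightarrow>
     (\<exists>W S. open W \<and> m \<in> W \<and> open S \<and> smooth_on S \<phi> \<and>
        (\<forall>m'\<in>W. top_view (X m') \<in> S \<and> zc X m' = \<phi> (top_view (X m'))))"

text \<open>The value is determined by the surface wherever the top view is an immersion, since there the
  germ of \<open>\<phi>\<close> is unique; elsewhere it is unspecified.\<close>

definition isotropic_K :: "surface \<Rightarrow> plane_point \<Rightarrow> real" where
  "isotropic_K X m = (THE k. \<exists>\<phi>. local_graph X m \<phi> \<and>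
     k = Du (Du \<phi>) (top_view (X m)) * Dv (Dv \<phi>) (top_view (X m))
         - (Dv (Du \<phi>) (top_view (X m)))\<^sup>2)"

definition deform :: "surface \<Rightarrow> surface \<Rightarrow> real \<Rightarrow> surface" where
  "deform X Y t m = X m + t *\<^sub>R Y m"

text \<open>The curvature of the deformed surface at a fixed parameter is only needed for small \<open>t\<close>, where
  its top view is still an immersion near that parameter.\<close>

definition velocity_diagram :: "plane_point set \<Rightarrow> surface \<Rightarrow> surface \<Rightarrow> bool" where
  "velocity_diagram U X Y \<longleftrightarrow> admissible U X \<and> smooth_on U Y \<and>
     (\<forall>m\<in>U.
        let Xu = (\<lambda>t. Du (top_view \<circ> deform X Y t) m);
            Xv = (\<lambda>t. Dv (top_view \<circ> deform X Y t) m)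
        in ((\<lambda>t. Xu t \<bullet> Xu t) has_real_derivative 0) (at 0) \<and>
           ((\<lambda>t. Xu t \<bullet> Xv t) has_real_derivative 0) (at 0) \<and>
           ((\<lambda>t. Xv t \<bullet> Xv t) has_real_derivative 0) (at 0) \<and>
           ((\<lambda>t. isotropic_K (deform X Y t) m) has_real_derivative 0) (at 0))"

type_synonym contact_element = "real \<times> real \<times> real \<times> real \<times> real"

definition contact_elements :: "surface \<Rightarrow> plane_point \<Rightarrow> contact_element set" where
  "contact_elements X m =
     {(x, y, z, p, q). X m = (x, y, z) \<and> (\<forall>\<tau>\<in>tangent_space X m. \<tau> \<bullet> (p, q, -1) = 0)}"

text \<open>\<open>differential_on U g X a b\<close> states \<open>dg = a dx + b dy\<close> for the coordinates \<open>x, y\<close> of \<open>X\<close>.\<close>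

definition differential_on ::
  "plane_point set \<Rightarrow> (plane_point \<Rightarrow> real) \<Rightarrow> surface \<Rightarrow> (plane_point \<Rightarrow> real) \<Rightarrow> (plane_point \<Rightarrow> real) \<Rightarrow> bool"
  where
  "differential_on U g X a b \<longleftrightarrow> (\<forall>m\<in>U. \<forall>w. frechet_derivative g (at m) w =
     a m * frechet_derivative (xc X) (at m) w + b m * frechet_derivative (yc X) (at m) w)"

text \<open>The rotation and translation diagrams are formed for velocity diagrams normalized to
  \<open>(-y, x, y\<^sub>3)\<close>.\<close>

definition normalized_velocity_diagram :: "plane_point set \<Rightarrow> surface \<Rightarrow> surface \<Rightarrow> bool" where
  "normalized_velocity_diagram U X Y \<longleftrightarrow> velocity_diagram U X Y \<and>
     (\<forall>m\<in>U. Y m = (- yc X m, xc X m, zc Y m))"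

definition translation_diagram :: "plane_point set \<Rightarrow> surface \<Rightarrow> surface \<Rightarrow> surface \<Rightarrow> bool" where
  "translation_diagram U X Y T \<longleftrightarrow> normalized_velocity_diagram U X Y \<and>
     (\<exists>a b. smooth_on U a \<and> smooth_on U b \<and> differential_on U (zc Y) X a b \<and>
        (\<forall>m\<in>U. T m = (- b m, a m, - zc Y m + a m * xc X m + b m * yc X m)))"

text \<open>A rotation diagram is only determined up to an additive (locally) constant function in its third component.\<close>

definition rotation_diagram :: "plane_point set \<Rightarrow> surface \<Rightarrow> surface \<Rightarrow> surface \<Rightarrow> bool" where
  "rotation_diagram U X Y R \<longleftrightarrow> normalized_velocity_diagram U X Y \<and>
     (\<exists>a b p q s. smooth_on U a \<and> smooth_on U b \<and> smooth_on U s \<and>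
        differential_on U (zc Y) X a b \<and>
        (\<forall>m\<in>U. (xc X m, yc X m, zc X m, p m, q m) \<in> contact_elements X m) \<and>
        (\<forall>m\<in>U. \<forall>w. frechet_derivative s (at m) w =
           - q m * frechet_derivative a (at m) w + p m * frechet_derivative b (at m) w) \<and>
        (\<forall>m\<in>U. R m = (- a m, - b m, s m)))"

definition wreath_step :: "plane_point set \<Rightarrow> surface \<times> surface \<Rightarrow> surface \<times> surface \<Rightarrow> bool" where
  "wreath_step U P Q \<longleftrightarrow>
     translation_diagram U (fst P) (snd P) (fst Q) \<and> rotation_diagram U (fst P) (snd P) (snd Q)"

text \<open>A Darboux wreath is given by the list of pairs of one period of the closed sequence.\<close>

definition darboux_wreath :: "plane_point set \<Rightarrow> (surface \<times> surface) list \<Rightarrow> bool" where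
  "darboux_wreath U Ps \<longleftrightarrow> Ps \<noteq> [] \<and>
     (\<forall>i<length Ps. wreath_step U (Ps ! i) (Ps ! (Suc i mod length Ps)))"

definition wreath_surfaces :: "(surface \<times> surface) list \<Rightarrow> surface set" where
  "wreath_surfaces Ps = fst ` set Ps \<union> snd ` set Ps"

definition I_orthogonal :: "plane_point set \<Rightarrow> surface \<Rightarrow> surface \<Rightarrow> bool" where
  "I_orthogonal U X Y \<longleftrightarrow> (\<forall>m\<in>U.
     Du (top_view \<circ> X) m \<bullet> Du (top_view \<circ> Y) m = 0 \<and>
     Dv (top_view \<circ> X) m \<bullet> Dv (top_view \<circ> Y) m = 0 \<and>
     Du (top_view \<circ> X) m \<bullet> Dv (top_view \<circ> Y) m + Dv (top_view \<circ> X) m \<bullet> Du (top_view \<circ> Y) m = 0)"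

fun metric_duality :: "contact_element \<Rightarrow> contact_element" where
  "metric_duality (x, y, z, p, q) = (p, q, p * x + q * y - z, x, y)"

definition duality_related :: "plane_point set \<Rightarrow> surface \<Rightarrow> surface \<Rightarrow> bool" where
  "duality_related U X Y \<longleftrightarrow> admissible U X \<and> admissible U Y \<and>
     (\<forall>m\<in>U. metric_duality ` contact_elements X m = contact_elements Y m)"

fun rot90 :: "space_point \<Rightarrow> space_point" where
  "rot90 (x, y, z) = (- y, x, z)"

definition parallel_tangent_planes :: "plane_point set \<Rightarrow> surface \<Rightarrow> surface \<Rightarrow> bool" where
  "parallel_tangent_planes U X Y \<longleftrightarrow> admissible U X \<and> admissible U Y \<and>
     (\<forall>m\<in>U. tangent_space X m = tangent_space Y m)"

end

theory Submission
  imports Defs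
begin

text \<open>
Describe a surface by its contact elements, that is, by functions \<open>x, y, z, p, q\<close> of the parameters with
\<open>dz = p dx + q dy\<close>, and a normalized velocity field \<open>(-y, x, w)\<close> along it by further functions \<open>w, a, b\<close>
with \<open>dw = a dx + b dy\<close>. In these terms everything becomes a statement about two-forms.

The isotropic curvature is the quotient of \<open>dp \<and> dq\<close> by \<open>dx \<and> dy\<close> (lemma \<open>isotropic_K_surf\<close>; as the
curvature is defined through local graphs, this uses a smooth version of the inverse function theorem
and the symmetry of second derivatives). The top view of the deformed surface at time \<open>t\<close> is the image of
\<open>(x, y)\<close> under the similarity \<open>1 + t J\<close>, with \<open>J\<close> the rotation by a right angle. Hence its curvature is
an explicit rational function of \<open>t\<close>, and the velocity field is an infinitesimal isometry if and only if
\<open>dp \<and> db + da \<and> dq = 0\<close> (lemma \<open>velocity_diagram_iff\<close>). This condition is symmetric enough to allow the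
surface and its velocity diagram to be exchanged (lemma \<open>velocity_diagrams\<close>), and it equals
\<open>d(-q da + p db) = 0\<close>, the condition for a rotation diagram.

Passing to the translation diagram, with the rotation diagram as its velocity, replaces
\<open>(x, y, z, p, q; w, a, b)\<close> by \<open>(-b, a, a x + b y - w, -y, x; s, -p, -q)\<close> where \<open>ds = -q da + p db\<close>. The
condition of flexibility for the new data is \<open>dp \<and> dx + dq \<and> dy = 0\<close>, which holds because \<open>ddz = 0\<close>
(lemma \<open>flexible_pair_next\<close>). As third coordinate of the next rotation diagram one can take the Legendre
transform \<open>p x + q y - z\<close> (lemma \<open>wreath_pair_next\<close>), and with this choice three steps return to the
start. In the course of these steps the immersion conditions are that \<open>dx \<and> dy\<close>, \<open>da \<and> db\<close> and
\<open>dp \<and> dq\<close> do not vanish; for graphs over the parameter plane, the last two are the assumptions on the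
Hessians of \<open>n\<close> and \<open>f\<close>. The duality and the parallel tangent planes are visible in the contact elements
of a single step (lemmas \<open>duality_related_surf\<close> and \<open>parallel_tangent_planes_surf\<close>). So every
claim about three pairs of surfaces is one fact about a single step, read off at the three steps of the
wreath.
\<close>

section \<open>Functions of class \<open>C\<^sup>k\<close>\<close>

lemma Ck_on_cong:
  assumes "open S" "\<And>m. m \<in> S \<Longrightarrow> g m = h m" "Ck_on k S g"
  shows "Ck_on k S h"
  using assms(2,3)
proof (induction k arbitrary: g h)
  case 0
  then show ?case using continuous_on_cong[of S S g h] by simp
next
  case (Suc k)
  have h: "(h has_derivative frechet_derivative g (at m)) (at m)" if "m \<in> S" for m
    using Suc.prems(2) that
    by (intro has_derivative_transform_within_open[OF _ assms(1) that Suc.prems(1)])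
       (simp_all add: frechet_derivative_works)
  then have "h differentiable at m" if "m \<in> S" for m
    using that differentiableI by blast
  moreover have "Ck_on k S (\<lambda>m. frechet_derivative h (at m) w)" for w
  proof (rule Suc.IH)
    show "frechet_derivative g (at m) w = frechet_derivative h (at m) w" if "m \<in> S" for m
      using frechet_derivative_at[OF h[OF that]] by simp
    show "Ck_on k S (\<lambda>m. frechet_derivative g (at m) w)" using Suc.prems(2) by simp
  qed
  ultimately show ?case by simp
qed

lemma Ck_on_SucD: "Ck_on (Suc k) S g \<Longrightarrow> Ck_on k S g"
proof (induction k arbitrary: g)
  case 0
  then show ?case
    by (simp add: differentiable_imp_continuous_on differentiable_at_withinI differentiable_on_def)
next
  case (Suc k)
  have "Ck_on (Suc k) S (\<lambda>m. frechet_derivative g (at m) w)" for w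
    using Suc.prems unfolding Ck_on.simps(2)[of "Suc k"] by blast
  from Suc.IH[OF this] show ?case using Suc.prems by simp
qed

text \<open>Together with \<open>Ck_on_SucD\<close>, this drives all closure properties below: each is an induction on the
order, with the derivative of the compound function given by the corresponding rule of calculus.\<close>

lemma Ck_on_SucI:
  assumes "open S" "\<And>m. m \<in> S \<Longrightarrow> (g has_derivative g' m) (at m)" "\<And>w. Ck_on k S (\<lambda>m. g' m w)"
  shows "Ck_on (Suc k) S g"
proof -
  have "g' m = frechet_derivative g (at m)" if "m \<in> S" for m
    using assms(2)[OF that] by (rule frechet_derivative_at)
  then have "Ck_on k S (\<lambda>m. frechet_derivative g (at m) w)" for w
    by (intro Ck_on_cong[OF assms(1) _ assms(3)[of w]]) simp
  then show ?thesis using assms(2) by (auto simp: differentiable_def)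
qed

lemma Ck_on_SucE:
  assumes "Ck_on (Suc k) S g" "m \<in> S"
  shows "(g has_derivative frechet_derivative g (at m)) (at m)"
  using assms frechet_derivative_works by auto

lemma Ck_on_const: "open S \<Longrightarrow> Ck_on k S (\<lambda>m. c)"
proof (induction k arbitrary: c)
  case (Suc k)
  show ?case
    by (rule Ck_on_SucI[where g'="\<lambda>m w. 0", OF Suc.prems has_derivative_const Suc.IH[OF Suc.prems]])
qed simp

lemma Ck_on_bounded_linear:
  assumes "open S" "bounded_linear L"
  shows "Ck_on k S g \<Longrightarrow> Ck_on k S (\<lambda>m. L (g m))"
proof (induction k arbitrary: g)
  case 0
  then show ?case by (simp add: bounded_linear.continuous_on[OF assms(2)])
next
  case (Suc k)
  let ?D = "\<lambda>m w. L (frechet_derivative g (at m) w)"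
  have 3: "Ck_on k S (\<lambda>m. ?D m w)" for w
    by (rule Suc.IH) (use Suc.prems in simp)
  have 4: "((\<lambda>m. L (g m)) has_derivative ?D m) (at m)" if "m \<in> S" for m
    by (rule bounded_linear.has_derivative[OF assms(2) Ck_on_SucE[OF Suc.prems that]])
  show ?case by (rule Ck_on_SucI[where g'="?D", OF assms(1) 4 3])
qed

lemma Ck_on_ident:
  assumes "open S"
  shows "Ck_on k S (\<lambda>m. m)"
proof (cases k)
  case (Suc k')
  show ?thesis unfolding Suc
    by (rule Ck_on_SucI[where g'="\<lambda>m w. w", OF assms has_derivative_ident Ck_on_const[OF assms]])
qed simp

lemma Ck_on_add:
  assumes "open S"
  shows "Ck_on k S g \<Longrightarrow> Ck_on k S h \<Longrightarrow> Ck_on k S (\<lambda>m. g m + h m)"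
proof (induction k arbitrary: g h)
  case 0
  then show ?case by (simp add: continuous_on_add)
next
  case (Suc k)
  let ?D = "\<lambda>m w. frechet_derivative g (at m) w + frechet_derivative h (at m) w"
  have 2: "Ck_on k S (\<lambda>m. frechet_derivative g (at m) w)"
    "Ck_on k S (\<lambda>m. frechet_derivative h (at m) w)" for w
    using Suc.prems by simp_all
  have 3: "Ck_on k S (\<lambda>m. ?D m w)" for w
    by (rule Suc.IH[OF 2])
  have 4: "((\<lambda>m. g m + h m) has_derivative ?D m) (at m)" if "m \<in> S" for m
    by (rule has_derivative_add[OF Ck_on_SucE[OF Suc.prems(1) that] Ck_on_SucE[OF Suc.prems(2) that]])
  show ?case by (rule Ck_on_SucI[where g'="?D", OF assms(1) 4 3])
qed

lemma Ck_on_mult: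
  fixes g h :: "'a::real_normed_vector \<Rightarrow> real"
  assumes "open S"
  shows "Ck_on k S g \<Longrightarrow> Ck_on k S h \<Longrightarrow> Ck_on k S (\<lambda>m. g m * h m)"
proof (induction k arbitrary: g h)
  case 0
  then show ?case by (simp add: continuous_on_mult)
next
  case (Suc k)
  let ?D = "\<lambda>m w. g m * frechet_derivative h (at m) w + frechet_derivative g (at m) w * h m"
  have 1: "Ck_on k S g" "Ck_on k S h"
    using Suc.prems[THEN Ck_on_SucD] .
  have 2: "Ck_on k S (\<lambda>m. frechet_derivative g (at m) w)"
    "Ck_on k S (\<lambda>m. frechet_derivative h (at m) w)" for w
    using Suc.prems by simp_all
  have 3: "Ck_on k S (\<lambda>m. ?D m w)" for w
    by (rule Ck_on_add[OF assms(1) Suc.IH[OF 1(1) 2(2)] Suc.IH[OF 2(1) 1(2)]])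
  have 4: "((\<lambda>m. g m * h m) has_derivative ?D m) (at m)" if "m \<in> S" for m
    by (rule has_derivative_mult[OF Ck_on_SucE[OF Suc.prems(1) that] Ck_on_SucE[OF Suc.prems(2) that]])
  show ?case by (rule Ck_on_SucI[where g'="?D", OF assms(1) 4 3])
qed

lemma Ck_on_uminus:
  "open S \<Longrightarrow> Ck_on k S g \<Longrightarrow> Ck_on k S (\<lambda>m. - g m)"
  by (rule Ck_on_bounded_linear[where L=uminus]) (auto intro: bounded_linear_minus bounded_linear_ident)

lemma Ck_on_inverse:
  fixes h :: "'a::real_normed_vector \<Rightarrow> real"
  assumes "open S" "\<And>m. m \<in> S \<Longrightarrow> h m \<noteq> 0"
  shows "Ck_on k S h \<Longrightarrow> Ck_on k S (\<lambda>m. inverse (h m))"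
proof (induction k)
  case 0
  then show ?case using assms by (simp add: continuous_on_inverse)
next
  case (Suc k)
  let ?D = "\<lambda>m w. - (inverse (h m) * frechet_derivative h (at m) w * inverse (h m))"
  have 1: "Ck_on k S (\<lambda>m. inverse (h m))"
    by (rule Suc.IH[OF Ck_on_SucD[OF Suc.prems]])
  have 2: "Ck_on k S (\<lambda>m. frechet_derivative h (at m) w)" for w
    using Suc.prems by simp
  have 3: "Ck_on k S (\<lambda>m. ?D m w)" for w
    by (rule Ck_on_uminus[OF assms(1) Ck_on_mult[OF assms(1) Ck_on_mult[OF assms(1) 1 2] 1]])
  have 4: "((\<lambda>m. inverse (h m)) has_derivative ?D m) (at m)" if "m \<in> S" for m
    by (rule Deriv.has_derivative_inverse[OF assms(2)[OF that] Ck_on_SucE[OF Suc.prems that]])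
  show ?case by (rule Ck_on_SucI[where g'="?D", OF assms(1) 4 3])
qed

lemma Ck_on_Pair:
  assumes "open S" "Ck_on k S g" "Ck_on k S h"
  shows "Ck_on k S (\<lambda>m. (g m, h m))"
proof -
  have 1: "Ck_on k S (\<lambda>m. (g m, 0) + (0, h m))"
    using assms
    by (intro Ck_on_add Ck_on_bounded_linear[where L="\<lambda>x. (x, 0)"]
        Ck_on_bounded_linear[where L="\<lambda>x. (0, x)"])
       (auto intro!: bounded_linear_Pair bounded_linear_ident bounded_linear_zero)
  show ?thesis by (rule Ck_on_cong[OF assms(1) _ 1]) simp
qed

lemma frechet_derivative_plane:
  fixes g :: "plane_point \<Rightarrow> 'b::real_normed_vector"
  assumes "g differentiable at m"
  shows "frechet_derivative g (at m) w = fst w *\<^sub>R Du g m + snd w *\<^sub>R Dv g m"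
proof -
  interpret linear "frechet_derivative g (at m)" by (rule linear_frechet_derivative[OF assms])
  have "w = fst w *\<^sub>R (1,0) + snd w *\<^sub>R (0,1)" by (cases w) simp
  then show ?thesis unfolding Du_def Dv_def by (metis add scaleR)
qed

lemma Ck_on_compose_plane:
  fixes F :: "plane_point \<Rightarrow> real" and g h :: "'a::real_normed_vector \<Rightarrow> real"
  assumes "open S" "open T" "\<And>m. m \<in> S \<Longrightarrow> (g m, h m) \<in> T"
  shows "Ck_on k T F \<Longrightarrow> Ck_on k S g \<Longrightarrow> Ck_on k S h \<Longrightarrow> Ck_on k S (\<lambda>m. F (g m, h m))"
proof (induction k arbitrary: F)
  case 0
  then show ?case using assms(3)
    by (auto intro!: continuous_on_compose2[of T F S "\<lambda>m. (g m, h m)"] continuous_on_Pair)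
next
  case (Suc k)
  let ?D = "\<lambda>m w. frechet_derivative g (at m) w * Du F (g m, h m)
      + frechet_derivative h (at m) w * Dv F (g m, h m)"
  have 4: "((\<lambda>m. F (g m, h m)) has_derivative ?D m) (at m)" if m: "m \<in> S" for m
  proof -
    have F: "F differentiable at (g m, h m)" using Suc.prems(1) assms(3)[OF m] by simp
    have "((\<lambda>m. (g m, h m)) has_derivative
        (\<lambda>w. (frechet_derivative g (at m) w, frechet_derivative h (at m) w))) (at m)"
      by (intro has_derivative_Pair Ck_on_SucE[OF Suc.prems(2) m] Ck_on_SucE[OF Suc.prems(3) m])
    from has_derivative_compose[OF this F[unfolded frechet_derivative_works]]
    show ?thesis by (simp add: frechet_derivative_plane[OF F])
  qed
  have 1: "Ck_on k S g" "Ck_on k S h"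
    using Suc.prems(2,3)[THEN Ck_on_SucD] .
  have 2: "Ck_on k S (\<lambda>m. frechet_derivative g (at m) w)"
    "Ck_on k S (\<lambda>m. frechet_derivative h (at m) w)" "Ck_on k T (Du F)" "Ck_on k T (Dv F)" for w
    using Suc.prems by (simp_all add: Du_def[abs_def] Dv_def[abs_def])
  have 3: "Ck_on k S (\<lambda>m. ?D m w)" for w
    by (rule Ck_on_add[OF assms(1) Ck_on_mult[OF assms(1) 2(1) Suc.IH[OF 2(3) 1]]
          Ck_on_mult[OF assms(1) 2(2) Suc.IH[OF 2(4) 1]]])
  show ?case by (rule Ck_on_SucI[where g'="?D", OF assms(1) 4 3])
qed

named_theorems smooth

lemma smooth_onD: "smooth_on S g \<Longrightarrow> Ck_on k S g" by (simp add: smooth_on_def)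

lemma smooth_on_differentiable: "smooth_on S g \<Longrightarrow> m \<in> S \<Longrightarrow> g differentiable at m"
  using smooth_onD[of S g "Suc 0"] by simp

lemma smooth_on_subset: "smooth_on S g \<Longrightarrow> T \<subseteq> S \<Longrightarrow> smooth_on T g"
proof -
  have "Ck_on k T g" if "Ck_on k S g" "T \<subseteq> S" for k
    using that(1)
  proof (induction k arbitrary: g)
    case 0
    then show ?case using continuous_on_subset[OF _ that(2)] by simp
  next
    case (Suc k)
    then show ?case using that(2) by (simp add: subset_iff)
  qed
  then show "smooth_on S g \<Longrightarrow> T \<subseteq> S \<Longrightarrow> smooth_on T g" by (simp add: smooth_on_def)
qed

lemma smooth_on_const [smooth]: "open S \<Longrightarrow> smooth_on S (\<lambda>m. c)"
  by (simp add: smooth_on_def Ck_on_const)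

lemma smooth_on_bounded_linear:
  "open S \<Longrightarrow> bounded_linear L \<Longrightarrow> smooth_on S g \<Longrightarrow> smooth_on S (\<lambda>m. L (g m))"
  by (simp add: smooth_on_def Ck_on_bounded_linear)

lemma smooth_on_fst [smooth]: "open S \<Longrightarrow> smooth_on S fst"
  using smooth_on_bounded_linear[OF _ bounded_linear_fst, of S "\<lambda>m. m"]
  by (simp add: smooth_on_def Ck_on_ident)

lemma smooth_on_snd [smooth]: "open S \<Longrightarrow> smooth_on S snd"
  using smooth_on_bounded_linear[OF _ bounded_linear_snd, of S "\<lambda>m. m"]
  by (simp add: smooth_on_def Ck_on_ident)

lemma smooth_on_add [smooth]:
  "open S \<Longrightarrow> smooth_on S g \<Longrightarrow> smooth_on S h \<Longrightarrow> smooth_on S (\<lambda>m. g m + h m)"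
  by (simp add: smooth_on_def Ck_on_add)

lemma smooth_on_uminus [smooth]:
  "open S \<Longrightarrow> smooth_on S g \<Longrightarrow> smooth_on S (\<lambda>m. - g m)"
  by (simp add: smooth_on_def Ck_on_uminus)

lemma smooth_on_diff [smooth]:
  "open S \<Longrightarrow> smooth_on S g \<Longrightarrow> smooth_on S h \<Longrightarrow> smooth_on S (\<lambda>m. g m - h m)"
  using smooth_on_add[of S g "\<lambda>m. - h m"] smooth_on_uminus[of S h] by simp

lemma smooth_on_mult [smooth]:
  fixes g h :: "'a::real_normed_vector \<Rightarrow> real"
  shows "open S \<Longrightarrow> smooth_on S g \<Longrightarrow> smooth_on S h \<Longrightarrow> smooth_on S (\<lambda>m. g m * h m)"
  by (simp add: smooth_on_def Ck_on_mult)

lemma smooth_on_Pair [smooth]: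
  "open S \<Longrightarrow> smooth_on S g \<Longrightarrow> smooth_on S h \<Longrightarrow> smooth_on S (\<lambda>m. (g m, h m))"
  by (simp add: smooth_on_def Ck_on_Pair)

lemma smooth_on_Du [smooth]: "smooth_on S g \<Longrightarrow> smooth_on S (Du g)"
  using smooth_onD[of S g "Suc _"] by (simp add: smooth_on_def Du_def[abs_def])

lemma smooth_on_Dv [smooth]: "smooth_on S g \<Longrightarrow> smooth_on S (Dv g)"
  using smooth_onD[of S g "Suc _"] by (simp add: smooth_on_def Dv_def[abs_def])

text \<open>The function \<open>c\<close> of the theorem is only known to be differentiable; its smoothness comes from that
of its prescribed partial derivatives.\<close>

lemma smooth_on_if_smooth_partials:
  fixes g :: "plane_point \<Rightarrow> real"
  assumes "open S" "\<And>m. m \<in> S \<Longrightarrow> g differentiable at m"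
    and "\<And>m. m \<in> S \<Longrightarrow> Du g m = gu m" "\<And>m. m \<in> S \<Longrightarrow> Dv g m = gv m"
    and "smooth_on S gu" "smooth_on S gv"
  shows "smooth_on S g"
  unfolding smooth_on_def
proof
  fix k
  have "Ck_on (Suc k) S g"
  proof (rule Ck_on_SucI[OF assms(1)])
    show "(g has_derivative (\<lambda>w. fst w * gu m + snd w * gv m)) (at m)" if "m \<in> S" for m
    proof -
      have "frechet_derivative g (at m) = (\<lambda>w. fst w * gu m + snd w * gv m)"
        using assms(2-4) that by (simp add: fun_eq_iff frechet_derivative_plane)
      then show ?thesis using assms(2)[OF that] by (simp add: frechet_derivative_works)
    qed
    show "Ck_on k S (\<lambda>m. fst w * gu m + snd w * gv m)" for w
      using assms by (intro Ck_on_add Ck_on_mult Ck_on_const smooth_onD)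
  qed
  then show "Ck_on k S g" by (rule Ck_on_SucD)
qed

section \<open>Partial derivatives in the parameter plane\<close>

lemma partials_eqI:
  assumes "(g has_derivative g') (at m)"
  shows "Du g m = g' (1, 0)" "Dv g m = g' (0, 1)"
  using frechet_derivative_at[OF assms] by (simp_all add: Du_def Dv_def)

lemma partials_const: "Du (\<lambda>m. c) m = 0" "Dv (\<lambda>m. c) m = 0"
  by (simp_all add: Du_def Dv_def)

lemma partials_fst_snd: "Du fst m = 1" "Dv fst m = 0" "Du snd m = 0" "Dv snd m = 1"
  by (simp_all add: partials_eqI[OF has_derivative_fst[OF has_derivative_ident]]
      partials_eqI[OF has_derivative_snd[OF has_derivative_ident]])

lemma partials_add:
  assumes "g differentiable at m" "h differentiable at m"
  shows "Du (\<lambda>m. g m + h m) m = Du g m + Du h m" "Dv (\<lambda>m. g m + h m) m = Dv g m + Dv h m"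
  using partials_eqI[OF has_derivative_add[OF assms[unfolded frechet_derivative_works]]]
  by (simp_all add: Du_def Dv_def)

lemma partials_diff:
  assumes "g differentiable at m" "h differentiable at m"
  shows "Du (\<lambda>m. g m - h m) m = Du g m - Du h m" "Dv (\<lambda>m. g m - h m) m = Dv g m - Dv h m"
  using partials_eqI[OF has_derivative_diff[OF assms[unfolded frechet_derivative_works]]]
  by (simp_all add: Du_def Dv_def)

lemma partials_uminus:
  assumes "g differentiable at m"
  shows "Du (\<lambda>m. - g m) m = - Du g m" "Dv (\<lambda>m. - g m) m = - Dv g m"
  using partials_eqI[OF has_derivative_minus[OF assms[unfolded frechet_derivative_works]]]
  by (simp_all add: Du_def Dv_def)

lemma partials_mult:
  fixes g h :: "plane_point \<Rightarrow> real"
  assumes "g differentiable at m" "h differentiable at m"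
  shows "Du (\<lambda>m. g m * h m) m = g m * Du h m + Du g m * h m"
    "Dv (\<lambda>m. g m * h m) m = g m * Dv h m + Dv g m * h m"
  using partials_eqI[OF has_derivative_mult[OF assms[unfolded frechet_derivative_works]]]
  by (simp_all add: Du_def Dv_def)

lemma partials_Pair:
  assumes "g differentiable at m" "h differentiable at m"
  shows "Du (\<lambda>m. (g m, h m)) m = (Du g m, Du h m)" "Dv (\<lambda>m. (g m, h m)) m = (Dv g m, Dv h m)"
  using partials_eqI[OF has_derivative_Pair[OF assms[unfolded frechet_derivative_works]]]
  by (simp_all add: Du_def Dv_def)

lemma partials_cong:
  assumes "open S" "m \<in> S" "\<And>m. m \<in> S \<Longrightarrow> g m = h m" "g differentiable at m"
  shows "Du g m = Du h m" "Dv g m = Dv h m"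
  using frechet_derivative_transform_within_open[OF assms(4,1,2,3)] by (simp_all add: Du_def Dv_def)

lemma partials_compose_plane:
  fixes F :: "plane_point \<Rightarrow> real"
  assumes "F differentiable at (x m, y m)" "x differentiable at m" "y differentiable at m"
  shows "Du (\<lambda>m. F (x m, y m)) m = Du F (x m, y m) * Du x m + Dv F (x m, y m) * Du y m"
    "Dv (\<lambda>m. F (x m, y m)) m = Du F (x m, y m) * Dv x m + Dv F (x m, y m) * Dv y m"
  using partials_eqI[OF has_derivative_compose[OF has_derivative_Pair[OF
        assms(2,3)[unfolded frechet_derivative_works]] assms(1)[unfolded frechet_derivative_works]]]
  by (simp_all add: frechet_derivative_plane[OF assms(1)] frechet_derivative_plane[OF assms(2)]
      frechet_derivative_plane[OF assms(3)])

lemma has_real_derivative_slices: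
  fixes g :: "plane_point \<Rightarrow> real"
  assumes "g differentiable at (s, t)"
  shows "((\<lambda>s. g (s, t)) has_real_derivative Du g (s, t)) (at s)"
    "((\<lambda>t. g (s, t)) has_real_derivative Dv g (s, t)) (at t)"
proof -
  have g: "(g has_derivative (\<lambda>w. fst w * Du g (s, t) + snd w * Dv g (s, t))) (at (s, t))"
    using assms unfolding frechet_derivative_works
    by (rule has_derivative_eq_rhs) (simp add: fun_eq_iff frechet_derivative_plane[OF assms])
  have "((\<lambda>s. (s, t)) has_derivative (\<lambda>h. (h, 0))) (at s)"
    "((\<lambda>t. (s, t)) has_derivative (\<lambda>h. (0, h))) (at t)"
    by (auto intro!: derivative_eq_intros)
  from this[THEN has_derivative_compose, of g, OF g]
  show "((\<lambda>s. g (s, t)) has_real_derivative Du g (s, t)) (at s)"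
    "((\<lambda>t. g (s, t)) has_real_derivative Dv g (s, t)) (at t)"
    by (auto simp: has_field_derivative_def elim!: has_derivative_eq_rhs)
qed

text \<open>The mean value theorem, applied first in one variable and then in the other. The second difference
on the left is symmetric in the two variables, which is what makes mixed partial derivatives agree.\<close>

lemma second_difference_mean_value:
  fixes G G1 G12 :: "real \<Rightarrow> real \<Rightarrow> real"
  assumes "h > 0"
    and G1: "\<And>s t. s \<in> {a..a+h} \<Longrightarrow> t \<in> {b..b+h} \<Longrightarrow> ((\<lambda>s. G s t) has_real_derivative G1 s t) (at s)"
    and G12: "\<And>s t. s \<in> {a..a+h} \<Longrightarrow> t \<in> {b..b+h} \<Longrightarrow> (G1 s has_real_derivative G12 s t) (at t)"
  obtains s t where "s \<in> {a..a+h}" "t \<in> {b..b+h}"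
    "G (a+h) (b+h) - G a (b+h) - G (a+h) b + G a b = h\<^sup>2 * G12 s t"
proof -
  have "\<exists>s. a < s \<and> s < a+h \<and> (G (a+h) (b+h) - G (a+h) b) - (G a (b+h) - G a b)
      = (a + h - a) * (G1 s (b+h) - G1 s b)"
    using assms(1)
    by (intro MVT2[of a "a+h" "\<lambda>s. G s (b+h) - G s b" "\<lambda>s. G1 s (b+h) - G1 s b"] DERIV_diff G1) auto
  then obtain s where s: "a < s" "s < a+h"
    "G (a+h) (b+h) - G a (b+h) - G (a+h) b + G a b = h * (G1 s (b+h) - G1 s b)"
    by (auto simp: algebra_simps)
  have "\<exists>t. b < t \<and> t < b+h \<and> G1 s (b+h) - G1 s b = (b + h - b) * G12 s t"
    using assms(1) s by (intro MVT2 G12) auto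
  then obtain t where "b < t" "t < b+h" "G1 s (b+h) - G1 s b = h * G12 s t" by auto
  with s show ?thesis by (intro that[of s t]) (auto simp: power2_eq_square)
qed

lemma smooth_on_isCont: "smooth_on S g \<Longrightarrow> m \<in> S \<Longrightarrow> isCont g m"
  by (simp add: differentiable_imp_continuous_within smooth_on_differentiable)

text \<open>On arbitrarily small squares at \<open>m\<close>, the second difference of \<open>g\<close> is the area times a value of either
mixed derivative; both are continuous at \<open>m\<close>.\<close>

lemma mixed_partials_commute:
  fixes g :: "plane_point \<Rightarrow> real"
  assumes "open S" "smooth_on S g" "m \<in> S"
  shows "Du (Dv g) m = Dv (Du g) m"
proof -
  obtain a b where m: "m = (a, b)" by (cases m)
  have "\<bar>Du (Dv g) m - Dv (Du g) m\<bar> \<le> 0 + e" if "e > 0" for e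
  proof -
    have ev: "\<forall>\<^sub>F z in nhds m. dist (A z) (A m) < e/2" if "isCont A m" for A :: "plane_point \<Rightarrow> real"
      using tendstoD[of A "A m" "nhds m" "e/2"] that \<open>e > 0\<close>
      by (simp add: isCont_def tendsto_at_iff_tendsto_nhds)
    then have "\<forall>\<^sub>F z in nhds m. z \<in> S \<and> dist (Du (Dv g) z) (Du (Dv g) m) < e/2
        \<and> dist (Dv (Du g) z) (Dv (Du g) m) < e/2"
      using assms by (intro eventually_conj eventually_nhds_in_open ev) (auto intro!: smooth_on_isCont smooth)
    then obtain r where r: "r > 0" and ball: "\<And>z. dist z m < r \<Longrightarrow> z \<in> S
        \<and> dist (Du (Dv g) z) (Du (Dv g) m) < e/2 \<and> dist (Dv (Du g) z) (Dv (Du g) m) < e/2"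
      unfolding eventually_nhds_metric by blast
    define h where "h = r/3"
    have h: "h > 0" using r by (simp add: h_def)
    have near: "dist (s, t) m < r" if "s \<in> {a..a+h}" "t \<in> {b..b+h}" for s t
    proof -
      have "dist (s, t) m \<le> \<bar>s - a\<bar> + \<bar>t - b\<bar>"
        using sqrt_sum_squares_le_sum_abs[of "s-a" "t-b"] by (simp add: m dist_Pair_Pair dist_real_def)
      also have "\<dots> \<le> h + h" using that by auto
      finally show ?thesis using r by (simp add: h_def)
    qed
    have d: "g differentiable at (s, t)" "Du g differentiable at (s, t)" "Dv g differentiable at (s, t)"
      if "s \<in> {a..a+h}" "t \<in> {b..b+h}" for s t
      using ball[OF near[OF that]] assms(2) by (auto intro!: smooth_on_differentiable[of S] smooth)
    obtain s t where st: "s \<in> {a..a+h}" "t \<in> {b..b+h}"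
      "g (a+h, b+h) - g (a, b+h) - g (a+h, b) + g (a, b) = h\<^sup>2 * Dv (Du g) (s, t)"
      using second_difference_mean_value[OF h, of a b "\<lambda>s t. g (s, t)" "\<lambda>s t. Du g (s, t)"
          "\<lambda>s t. Dv (Du g) (s, t)"]
        has_real_derivative_slices d by metis
    \<comment> \<open>The same second difference, with the two variables exchanged.\<close>
    obtain s' t' where st': "s' \<in> {a..a+h}" "t' \<in> {b..b+h}"
      "g (a+h, b+h) - g (a+h, b) - g (a, b+h) + g (a, b) = h\<^sup>2 * Du (Dv g) (s', t')"
      using second_difference_mean_value[OF h, of b a "\<lambda>t s. g (s, t)" "\<lambda>t s. Dv g (s, t)"
          "\<lambda>t s. Du (Dv g) (s, t)"]
        has_real_derivative_slices d by metis
    have "h\<^sup>2 * Dv (Du g) (s, t) = h\<^sup>2 * Du (Dv g) (s', t')"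
      using st(3) st'(3) by linarith
    then have "Dv (Du g) (s, t) = Du (Dv g) (s', t')"
      using h by simp
    then show ?thesis
      using ball[OF near[OF st(1,2)]] ball[OF near[OF st'(1,2)]] unfolding dist_real_def by arith
  qed
  then show ?thesis using field_le_epsilon[of "\<bar>Du (Dv g) m - Dv (Du g) m\<bar>" 0] by simp
qed

lemma smooth_on_compose_plane:
  fixes F :: "plane_point \<Rightarrow> real" and g h :: "'a::real_normed_vector \<Rightarrow> real"
  assumes "open S" "open T" "\<And>m. m \<in> S \<Longrightarrow> (g m, h m) \<in> T"
    and "smooth_on T F" "smooth_on S g" "smooth_on S h"
  shows "smooth_on S (\<lambda>m. F (g m, h m))"
  using assms unfolding smooth_on_def by (intro allI Ck_on_compose_plane) auto

section \<open>Smooth local inverses in the plane\<close>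

text \<open>The coefficient of \<open>dg \<and> dh\<close> with respect to \<open>du \<and> dv\<close>. The proof is a computation with such two-forms.\<close>

definition jac :: "(plane_point \<Rightarrow> real) \<Rightarrow> (plane_point \<Rightarrow> real) \<Rightarrow> plane_point \<Rightarrow> real" where
  "jac g h m = Du g m * Dv h m - Dv g m * Du h m"

lemma smooth_on_jac [smooth]: "open S \<Longrightarrow> smooth_on S g \<Longrightarrow> smooth_on S h \<Longrightarrow> smooth_on S (jac g h)"
  unfolding jac_def[abs_def] by (intro smooth)

text \<open>A differentiable inverse gains one order of smoothness from its own derivative: by Cramer's rule the
partial derivatives of \<open>(g, h)\<close> are rational expressions in smooth functions composed with \<open>(g, h)\<close>,
so they are of class \<open>C\<^sup>k\<close> as soon as \<open>(g, h)\<close> is.\<close>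

lemma inverse_smooth:
  fixes x y g h :: "plane_point \<Rightarrow> real"
  assumes "open S" "open U" "smooth_on U x" "smooth_on U y" "\<And>m. m \<in> U \<Longrightarrow> jac x y m \<noteq> 0"
    and U: "\<And>s. s \<in> S \<Longrightarrow> (g s, h s) \<in> U"
    and inv: "\<And>s. s \<in> S \<Longrightarrow> (x (g s, h s), y (g s, h s)) = s"
    and diff: "\<And>s. s \<in> S \<Longrightarrow> g differentiable at s" "\<And>s. s \<in> S \<Longrightarrow> h differentiable at s"
  shows "smooth_on S g \<and> smooth_on S h"
proof -
  \<comment> \<open>Cramer's rule; the subtraction is written as a sum so that one smoothness fact below covers
    both derivatives.\<close>
  have D: "(g has_derivative (\<lambda>w. (fst w * Dv y (g s, h s) + (- snd w) * Dv x (g s, h s))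
        * inverse (jac x y (g s, h s)))) (at s)"
    "(h has_derivative (\<lambda>w. (snd w * Du x (g s, h s) + (- fst w) * Du y (g s, h s))
        * inverse (jac x y (g s, h s)))) (at s)"
    if s: "s \<in> S" for s
  proof -
    have d: "x differentiable at (g s, h s)" "y differentiable at (g s, h s)"
      using assms U[OF s] smooth_on_differentiable by blast+
    have i: "fst s = x (g s, h s)" "snd s = y (g s, h s)" if "s \<in> S" for s
      using inv[OF that] by (metis fst_conv, metis snd_conv)
    have dfs: "(fst :: plane_point \<Rightarrow> real) differentiable at s"
      "(snd :: plane_point \<Rightarrow> real) differentiable at s"
      using smooth_on_differentiable[OF smooth_on_fst[OF assms(1)] s]
        smooth_on_differentiable[OF smooth_on_snd[OF assms(1)] s] by auto
    have eqs: "Du x (g s, h s) * Du g s + Dv x (g s, h s) * Du h s = 1"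
      "Du x (g s, h s) * Dv g s + Dv x (g s, h s) * Dv h s = 0"
      "Du y (g s, h s) * Du g s + Dv y (g s, h s) * Du h s = 0"
      "Du y (g s, h s) * Dv g s + Dv y (g s, h s) * Dv h s = 1"
      using partials_cong[OF assms(1) s i(1) dfs(1)] partials_cong[OF assms(1) s i(2) dfs(2)]
      unfolding partials_fst_snd partials_compose_plane[OF d(1) diff[OF s]]
        partials_compose_plane[OF d(2) diff[OF s]]
      by simp_all
    let ?J = "jac x y (g s, h s)"
    have "Du g s * ?J = Dv y (g s, h s)" "Dv g s * ?J = - Dv x (g s, h s)"
      "Du h s * ?J = - Du y (g s, h s)" "Dv h s * ?J = Du x (g s, h s)"
      using eqs unfolding jac_def by algebra+
    moreover have "?J \<noteq> 0" using assms(5) U[OF s] by blast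
    ultimately have p: "Du g s = Dv y (g s, h s) * inverse ?J" "Dv g s = - Dv x (g s, h s) * inverse ?J"
      "Du h s = - Du y (g s, h s) * inverse ?J" "Dv h s = Du x (g s, h s) * inverse ?J"
      by (metis divide_inverse nonzero_eq_divide_eq)+
    show "(g has_derivative (\<lambda>w. (fst w * Dv y (g s, h s) + (- snd w) * Dv x (g s, h s)) * inverse ?J)) (at s)"
      "(h has_derivative (\<lambda>w. (snd w * Du x (g s, h s) + (- fst w) * Du y (g s, h s)) * inverse ?J)) (at s)"
      using diff[OF s] unfolding frechet_derivative_works
      by (auto elim!: has_derivative_eq_rhs
          simp: fun_eq_iff frechet_derivative_plane[OF diff(1)[OF s]]
            frechet_derivative_plane[OF diff(2)[OF s]] p algebra_simps)
  qed
  have "Ck_on k S g \<and> Ck_on k S h" for k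
  proof (induction k)
    case 0
    show ?case using diff
      by (simp add: differentiable_imp_continuous_on differentiable_at_withinI differentiable_on_def)
  next
    case (Suc k)
    have c: "Ck_on k S (\<lambda>s. F (g s, h s))" if "smooth_on U F" for F :: "plane_point \<Rightarrow> real"
      using Suc by (intro Ck_on_compose_plane[OF assms(1,2) U smooth_onD[OF that]]) auto
    have J: "Ck_on k S (\<lambda>s. inverse (jac x y (g s, h s)))"
      using U assms by (intro Ck_on_inverse c smooth) auto
    have 1: "Ck_on k S (\<lambda>s. (p * F (g s, h s) + q * G (g s, h s))
        * inverse (jac x y (g s, h s)))"
      if "smooth_on U F" "smooth_on U G" for p q F G
      by (intro Ck_on_mult Ck_on_add Ck_on_const c[OF that(1)] c[OF that(2)] J assms(1))
    have "Ck_on (Suc k) S g"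
      by (rule Ck_on_SucI[OF assms(1) D(1)]) (assumption, intro 1 smooth assms)
    moreover have "Ck_on (Suc k) S h"
      by (rule Ck_on_SucI[OF assms(1) D(2)]) (assumption, intro 1 smooth assms)
    ultimately show ?case by blast
  qed
  then show ?thesis by (simp add: smooth_on_def)
qed

text \<open>The inverse function theorem yields a differentiable local inverse; it has to be applied on the open
set where the Jacobian does not vanish, so that the preceding lemma makes the inverse smooth.\<close>

lemma smooth_local_inverse:
  assumes "open U" "smooth_on U x" "smooth_on U y" "m \<in> U" "jac x y m \<noteq> 0"
  obtains W S g h where "open W" "m \<in> W" "W \<subseteq> U" "open S"
    "\<And>m'. m' \<in> W \<Longrightarrow> (x m', y m') \<in> S \<and> (g (x m', y m'), h (x m', y m')) = m'"
    "\<And>s. s \<in> S \<Longrightarrow> (g s, h s) \<in> W" "smooth_on S g" "smooth_on S h"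
proof -
  define U0 where "U0 = {m \<in> U. jac x y m \<noteq> 0}"
  have "continuous_on U (jac x y)"
    using smooth_onD[OF smooth_on_jac[OF assms(1-3)], of 0] by simp
  then have U0: "open U0"
    unfolding U0_def using continuous_open_preimage[OF _ assms(1), of "jac x y" "- {0}"]
    by (simp add: vimage_def Int_def open_Compl)
  have sm: "smooth_on U0 x" "smooth_on U0 y"
    using assms(2,3) smooth_on_subset[of U _ U0] by (auto simp: U0_def)
  define T where "T m = (x m, y m)" for m
  have smT: "smooth_on U0 T" unfolding T_def[abs_def] using sm U0 by (intro smooth)
  define T' where "T' m = Blinfun (frechet_derivative T (at m))" for m
  have T': "blinfun_apply (T' m) = frechet_derivative T (at m)" if "m \<in> U0" for m
    using smooth_on_differentiable[OF smT that] unfolding T'_def frechet_derivative_works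
    by (intro bounded_linear_Blinfun_apply has_derivative_bounded_linear)
  have T'_eq: "blinfun_apply (T' m) w = (fst w * Du x m + snd w * Dv x m, fst w * Du y m + snd w * Dv y m)"
    if "m \<in> U0" for m w
  proof -
    have d: "x differentiable at m" "y differentiable at m"
      using sm that smooth_on_differentiable by blast+
    show ?thesis
      using frechet_derivative_plane[OF smooth_on_differentiable[OF smT that], of w]
      by (simp add: T'[OF that] T_def[abs_def] partials_Pair[OF d])
  qed
  have derT: "(T has_derivative blinfun_apply (T' m)) (at m)" if "m \<in> U0" for m
    using smooth_on_differentiable[OF smT that] unfolding T'[OF that] frechet_derivative_works .
  have contT: "continuous_on U0 T'"
  proof (rule continuous_on_blinfun_componentwise)
    fix w :: plane_point
    have "continuous_on U0 (\<lambda>m. frechet_derivative T (at m) w)"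
      using smooth_onD[OF smT, of "Suc 0"] by (cases w) simp
    then show "continuous_on U0 (\<lambda>m. blinfun_apply (T' m) w)"
      using T' continuous_on_cong[of U0 U0 "\<lambda>m. blinfun_apply (T' m) w" "\<lambda>m. frechet_derivative T (at m) w"]
      by simp
  qed
  have m0: "m \<in> U0" using assms by (simp add: U0_def)
  define I where "I w = ((fst w * Dv y m - snd w * Dv x m) / jac x y m,
    (snd w * Du x m - fst w * Du y m) / jac x y m)" for w
  have "bounded_linear I"
    unfolding I_def[abs_def] divide_inverse
    by (intro bounded_linear_Pair bounded_linear_mult_left bounded_linear_compose[OF bounded_linear_mult_left]
        bounded_linear_sub bounded_linear_fst bounded_linear_snd)
  then have "Blinfun I o\<^sub>L T' m = id_blinfun"
    using assms(5) m0 by (intro blinfun_eqI)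
      (simp add: bounded_linear_Blinfun_apply T'_eq I_def prod_eq_iff divide_eq_eq,
        simp add: jac_def algebra_simps)
  from inverse_function_theorem[OF U0 derT contT m0 this]
  obtain W S G G' where W: "open W" "W \<subseteq> U0" "m \<in> W" "open S" and hom: "homeomorphism W S T G"
    and G: "\<And>s. s \<in> S \<Longrightarrow> (G has_derivative (G' s)) (at s)" by metis
  define g h where "g s = fst (G s)" and "h s = snd (G s)" for s
  have gh: "(g s, h s) \<in> W" "(x (g s, h s), y (g s, h s)) = s" if "s \<in> S" for s
    using hom that by (auto simp: homeomorphism_def g_def h_def T_def)
  have "smooth_on S g \<and> smooth_on S h"
  proof (rule inverse_smooth)
    show "g differentiable at s" "h differentiable at s" if "s \<in> S" for s
      unfolding g_def[abs_def] h_def[abs_def]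
      using has_derivative_fst[OF G[OF that]] has_derivative_snd[OF G[OF that]] differentiableI by blast+
    show "jac x y s \<noteq> 0" if "s \<in> U0" for s using that by (simp add: U0_def)
    show "(g s, h s) \<in> U0" if "s \<in> S" for s using gh(1)[OF that] W by blast
  qed (use gh sm W U0 in auto)
  moreover have "(x m', y m') \<in> S \<and> (g (x m', y m'), h (x m', y m')) = m'" if "m' \<in> W" for m'
    using hom that by (auto simp: homeomorphism_def g_def h_def T_def)
  ultimately show ?thesis
    using W gh U0_def by (intro that[of W S g h]) auto
qed

section \<open>Contact elements and isotropic curvature of a parametrized surface\<close>

definition surf :: "(plane_point \<Rightarrow> real) \<Rightarrow> (plane_point \<Rightarrow> real) \<Rightarrow> (plane_point \<Rightarrow> real) \<Rightarrow> surface" where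
  "surf x y z m = (x m, y m, z m)"

text \<open>The relation \<open>dg = a dx + b dy\<close>.\<close>

definition total_differential ::
  "plane_point set \<Rightarrow> (plane_point \<Rightarrow> real) \<Rightarrow> (plane_point \<Rightarrow> real) \<Rightarrow> (plane_point \<Rightarrow> real)
     \<Rightarrow> (plane_point \<Rightarrow> real) \<Rightarrow> (plane_point \<Rightarrow> real) \<Rightarrow> bool" where
  "total_differential U g a x b y \<longleftrightarrow> (\<forall>m\<in>U.
     Du g m = a m * Du x m + b m * Du y m \<and> Dv g m = a m * Dv x m + b m * Dv y m)"

lemma total_differentialD:
  assumes "total_differential U g a x b y" "m \<in> U"
  shows "Du g m = a m * Du x m + b m * Du y m" "Dv g m = a m * Dv x m + b m * Dv y m"
  using assms by (auto simp: total_differential_def)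

lemma frechet_derivative_total_differential:
  assumes "total_differential U g a x b y" "m \<in> U"
    and "g differentiable at m" "x differentiable at m" "y differentiable at m"
  shows "frechet_derivative g (at m) w
    = a m * frechet_derivative x (at m) w + b m * frechet_derivative y (at m) w"
  by (simp add: frechet_derivative_plane assms(3-5) total_differentialD[OF assms(1,2)] algebra_simps)

text \<open>This is \<open>0 = ddg = da \<and> dx + db \<and> dy\<close>.\<close>

lemma total_differential_closed:
  assumes "open U" "smooth_on U g" "smooth_on U a" "smooth_on U x" "smooth_on U b" "smooth_on U y"
    and dg: "total_differential U g a x b y" and m: "m \<in> U"
  shows "jac a x m + jac b y m = 0"
proof -
  have d: "h differentiable at m" if "smooth_on U h" for h :: "plane_point \<Rightarrow> real"
    using smooth_on_differentiable[OF that m] .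
  note ds = assms(2-6)[THEN d] assms(2-6)[THEN smooth_on_Du, THEN d] assms(2-6)[THEN smooth_on_Dv, THEN d]
  note comm = assms(2-6)[THEN mixed_partials_commute[OF assms(1) _ m]]
  have "Dv (Du g) m = Dv (\<lambda>m. a m * Du x m + b m * Du y m) m"
    by (rule partials_cong[OF assms(1) m _ ds(6)]) (rule total_differentialD[OF dg])
  moreover have "Du (Dv g) m = Du (\<lambda>m. a m * Dv x m + b m * Dv y m) m"
    by (rule partials_cong[OF assms(1) m _ ds(11)]) (rule total_differentialD[OF dg])
  ultimately show ?thesis
    using comm by (simp add: partials_add partials_mult ds jac_def algebra_simps)
qed

lemma linear_system_unique:
  fixes a b :: real
  assumes "xu * yv - xv * yu \<noteq> 0"
    and "a * xu + b * yu = a' * xu + b' * yu" "a * xv + b * yv = a' * xv + b' * yv"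
  shows "a = a'" "b = b'"
proof -
  have "(a - a') * (xu * yv - xv * yu) = 0" "(b - b') * (xu * yv - xv * yu) = 0"
    using assms(2,3) by algebra+
  then show "a = a'" "b = b'" using assms(1) by simp_all
qed

text \<open>A surface with immersed top view, given together with its contact elements: \<open>(p, q, -1)\<close> is normal to
the surface exactly because \<open>dz = p dx + q dy\<close>. Carrying \<open>p\<close> and \<open>q\<close> as data spares solving
this system for them in each computation.\<close>

locale contact_surface =
  fixes U :: "plane_point set" and x y z p q :: "plane_point \<Rightarrow> real"
  assumes open_U: "open U"
    and smooth_x: "smooth_on U x" and smooth_y: "smooth_on U y" and smooth_z: "smooth_on U z"
    and smooth_p: "smooth_on U p" and smooth_q: "smooth_on U q"
    and immersed: "m \<in> U \<Longrightarrow> jac x y m \<noteq> 0"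
    and dz: "total_differential U z p x q y"
begin

lemmas smooth_data = smooth_x smooth_y smooth_z smooth_p smooth_q

lemma diff_data:
  assumes "m \<in> U"
  shows "x differentiable at m" "y differentiable at m" "z differentiable at m"
    "p differentiable at m" "q differentiable at m"
  using smooth_data smooth_on_differentiable assms by blast+

lemma smooth_surf: "smooth_on U (surf x y z)"
  unfolding surf_def[abs_def] using open_U by (intro smooth smooth_data)

lemma frechet_derivative_surf:
  assumes m: "m \<in> U"
  shows "frechet_derivative (surf x y z) (at m) w
    = (let \<alpha> = frechet_derivative x (at m) w; \<beta> = frechet_derivative y (at m) w
       in (\<alpha>, \<beta>, p m * \<alpha> + q m * \<beta>))"
proof -
  have "(surf x y z has_derivative (\<lambda>w. (frechet_derivative x (at m) w, frechet_derivative y (at m) w,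
      frechet_derivative z (at m) w))) (at m)"
    unfolding surf_def[abs_def] using diff_data(1-3)[OF m]
    by (intro has_derivative_Pair) (simp_all add: frechet_derivative_works)
  from frechet_derivative_at[OF this, symmetric]
    frechet_derivative_total_differential[OF dz m diff_data(3,1,2)[OF m]]
  show ?thesis by (simp add: Let_def)
qed

lemma top_view_immersion:
  assumes m: "m \<in> U"
  shows "bij (\<lambda>w. (frechet_derivative x (at m) w, frechet_derivative y (at m) w))"
proof -
  let ?L = "\<lambda>w. (frechet_derivative x (at m) w, frechet_derivative y (at m) w)"
  let ?I = "\<lambda>v. ((fst v * Dv y m - snd v * Dv x m) / jac x y m,
    (snd v * Du x m - fst v * Du y m) / jac x y m)"
  have L: "?L w = (fst w * Du x m + snd w * Dv x m, fst w * Du y m + snd w * Dv y m)" for w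
    using diff_data[OF m] by (simp add: frechet_derivative_plane)
  have "?I (?L w) = w" for w
    using immersed[OF m] unfolding L
    by (simp add: prod_eq_iff divide_eq_eq, simp add: jac_def algebra_simps)
  moreover have "?L (?I w) = w" for w
    using immersed[OF m] unfolding L
    by (simp add: prod_eq_iff add_divide_distrib[symmetric] divide_eq_eq,
        simp add: jac_def algebra_simps)
  ultimately show ?thesis by (intro o_bij[of ?I]) (auto simp: fun_eq_iff)
qed

lemma tangent_space_surf:
  assumes m: "m \<in> U"
  shows "tangent_space (surf x y z) m = range (\<lambda>(\<alpha>, \<beta>). (\<alpha>, \<beta>, p m * \<alpha> + q m * \<beta>))"
proof -
  have "frechet_derivative (surf x y z) (at m) = (\<lambda>(\<alpha>, \<beta>). (\<alpha>, \<beta>, p m * \<alpha> + q m * \<beta>))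
      \<circ> (\<lambda>w. (frechet_derivative x (at m) w, frechet_derivative y (at m) w))"
    by (simp add: fun_eq_iff frechet_derivative_surf[OF m] Let_def)
  then show ?thesis
    by (simp only: tangent_space_def image_comp[symmetric] bij_is_surj[OF top_view_immersion[OF m]])
qed

lemma admissible_surf: "admissible U (surf x y z)"
  unfolding admissible_def
proof (intro conjI ballI)
  fix m assume m: "m \<in> U"
  show "inj (frechet_derivative (surf x y z) (at m))"
    by (rule injI, rule injD[OF bij_is_inj[OF top_view_immersion[OF m]]])
      (simp add: frechet_derivative_surf[OF m] Let_def)
  show "(0, 0, 1) \<notin> tangent_space (surf x y z) m"
    by (auto simp: tangent_space_surf[OF m])
qed (fact open_U smooth_surf)+

lemma contact_elements_surf:
  assumes m: "m \<in> U"
  shows "contact_elements (surf x y z) m = {(x m, y m, z m, p m, q m)}"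
proof -
  have "(\<forall>\<tau>\<in>tangent_space (surf x y z) m. \<tau> \<bullet> (p', q', -1) = 0) \<longleftrightarrow> p' = p m \<and> q' = q m" for p' q'
  proof
    assume *: "\<forall>\<tau>\<in>tangent_space (surf x y z) m. \<tau> \<bullet> (p', q', -1) = 0"
    have "(1, 0, p m) \<in> tangent_space (surf x y z) m" "(0, 1, q m) \<in> tangent_space (surf x y z) m"
      unfolding tangent_space_surf[OF m] by (auto intro: image_eqI[where x="(1, 0)"] image_eqI[where x="(0, 1)"])
    from this[THEN bspec[OF *]] show "p' = p m \<and> q' = q m" by simp
  qed (auto simp: tangent_space_surf[OF m] algebra_simps)
  then show ?thesis unfolding contact_elements_def by (auto simp: surf_def)
qed

text \<open>For \<open>z = \<phi>(x, y)\<close> the slopes \<open>p\<close>, \<open>q\<close> are the partial derivatives of \<open>\<phi>\<close> at the top view. So the map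
\<open>(u, v) \<mapsto> (p, q)\<close> is the gradient map of \<open>\<phi>\<close> after the top view, and its Jacobian is the Hessian
determinant of \<open>\<phi>\<close> times that of the top view.\<close>

lemma local_graph_curvature:
  assumes m: "m \<in> U" and "local_graph (surf x y z) m \<phi>"
  shows "Du (Du \<phi>) (x m, y m) * Dv (Dv \<phi>) (x m, y m) - (Dv (Du \<phi>) (x m, y m))\<^sup>2
    = jac p q m / jac x y m"
proof -
  from assms(2) obtain W S where W: "open W" "m \<in> W" "open S" "smooth_on S \<phi>"
    and graph: "\<And>m'. m' \<in> W \<Longrightarrow> (x m', y m') \<in> S \<and> z m' = \<phi> (x m', y m')"
    unfolding local_graph_def by (auto simp: surf_def zc_def)
  have N: "open (W \<inter> U)" "m \<in> W \<inter> U" using W open_U m by auto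
  have pq: "p m' = Du \<phi> (x m', y m')" "q m' = Dv \<phi> (x m', y m')" if m': "m' \<in> W \<inter> U" for m'
  proof -
    have d: "x differentiable at m'" "y differentiable at m'" "z differentiable at m'"
      "\<phi> differentiable at (x m', y m')"
      using diff_data m' smooth_on_differentiable[OF W(4)] graph by auto
    have "Du z m' = Du (\<lambda>m. \<phi> (x m, y m)) m'" "Dv z m' = Dv (\<lambda>m. \<phi> (x m, y m)) m'"
      using graph by (auto intro!: partials_cong[OF N(1) m' _ d(3)])
    then have e: "p m' * Du x m' + q m' * Du y m' = Du \<phi> (x m', y m') * Du x m' + Dv \<phi> (x m', y m') * Du y m'"
      "p m' * Dv x m' + q m' * Dv y m' = Du \<phi> (x m', y m') * Dv x m' + Dv \<phi> (x m', y m') * Dv y m'"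
      using total_differentialD[OF dz, of m'] m' by (simp_all add: partials_compose_plane d)
    have "Du x m' * Dv y m' - Dv x m' * Du y m' \<noteq> 0"
      using immersed m' by (simp add: jac_def)
    then show "p m' = Du \<phi> (x m', y m')" "q m' = Dv \<phi> (x m', y m')"
      using e by (rule linear_system_unique)+
  qed
  have S: "(x m, y m) \<in> S" using graph W by blast
  have d: "x differentiable at m" "y differentiable at m" "p differentiable at m" "q differentiable at m"
    "Du \<phi> differentiable at (x m, y m)" "Dv \<phi> differentiable at (x m, y m)"
    using diff_data[OF m] W(4) by (auto intro!: smooth_on_differentiable[OF _ S] smooth)
  have "Du p m = Du (\<lambda>m. Du \<phi> (x m, y m)) m" "Dv p m = Dv (\<lambda>m. Du \<phi> (x m, y m)) m"
    by (rule partials_cong[OF N _ d(3)], erule pq)+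
  moreover have "Du q m = Du (\<lambda>m. Dv \<phi> (x m, y m)) m" "Dv q m = Dv (\<lambda>m. Dv \<phi> (x m, y m)) m"
    by (rule partials_cong[OF N _ d(4)], erule pq)+
  ultimately have "jac p q m = (Du (Du \<phi>) (x m, y m) * Dv (Dv \<phi>) (x m, y m) - (Dv (Du \<phi>) (x m, y m))\<^sup>2) * jac x y m"
    unfolding jac_def using d mixed_partials_commute[OF W(3,4) S]
    by (simp add: partials_compose_plane power2_eq_square algebra_simps)
  then show ?thesis using immersed[OF m] by simp
qed

text \<open>The preceding lemma shows that all local graphs give the same value; a local graph exists because the
top view has a smooth local inverse, and \<open>\<phi>\<close> is \<open>z\<close> composed with it.\<close>

lemma isotropic_K_surf:
  assumes m: "m \<in> U"
  shows "isotropic_K (surf x y z) m = jac p q m / jac x y m"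
proof -
  obtain W S g h where W: "open W" "m \<in> W" "W \<subseteq> U" "open S"
    and inv: "\<And>m'. m' \<in> W \<Longrightarrow> (x m', y m') \<in> S \<and> (g (x m', y m'), h (x m', y m')) = m'"
    and gh: "\<And>s. s \<in> S \<Longrightarrow> (g s, h s) \<in> W" "smooth_on S g" "smooth_on S h"
    by (rule smooth_local_inverse[OF open_U smooth_x smooth_y m immersed[OF m]]) blast
  have "smooth_on S (\<lambda>s. z (g s, h s))"
    using W gh by (intro smooth_on_compose_plane[OF _ open_U _ smooth_z]) auto
  then have graph: "local_graph (surf x y z) m (\<lambda>s. z (g s, h s))"
    unfolding local_graph_def using W inv
    by (intro exI[of _ W] exI[of _ S]) (simp add: surf_def zc_def)
  have top: "top_view (surf x y z m) = (x m, y m)" by (simp add: surf_def)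
  show ?thesis
    unfolding isotropic_K_def top
  proof (rule the_equality)
    show "\<exists>\<phi>. local_graph (surf x y z) m \<phi> \<and> jac p q m / jac x y m
        = Du (Du \<phi>) (x m, y m) * Dv (Dv \<phi>) (x m, y m) - (Dv (Du \<phi>) (x m, y m))\<^sup>2"
      by (rule exI, rule conjI[OF graph]) (rule local_graph_curvature[OF m graph, symmetric])
  next
    fix k
    assume "\<exists>\<phi>. local_graph (surf x y z) m \<phi> \<and> k
        = Du (Du \<phi>) (x m, y m) * Dv (Dv \<phi>) (x m, y m) - (Dv (Du \<phi>) (x m, y m))\<^sup>2"
    then show "k = jac p q m / jac x y m" using local_graph_curvature[OF m] by force
  qed
qed

end

section \<open>Infinitesimal flexibility\<close>

text \<open>The vector field \<open>(-y, x, w)\<close> along the surface \<open>(x, y, z)\<close> has a top view that rotates the top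
view of the surface by a right angle, so lengths in the top view are stationary for free.\<close>

locale velocity_pair = contact_surface +
  fixes w a b :: "plane_point \<Rightarrow> real"
  assumes smooth_w: "smooth_on U w" and smooth_a: "smooth_on U a" and smooth_b: "smooth_on U b"
    and dw: "total_differential U w a x b y"
begin

lemmas smooth_all = smooth_data smooth_w smooth_a smooth_b

lemma diff_all:
  assumes "m \<in> U"
  shows "x differentiable at m" "y differentiable at m" "z differentiable at m"
    "p differentiable at m" "q differentiable at m"
    "w differentiable at m" "a differentiable at m" "b differentiable at m"
  using smooth_all smooth_on_differentiable assms by blast+

lemma deform_eq: "deform (surf x y z) (surf (\<lambda>m. - y m) x w) t
    = surf (\<lambda>m. x m - t * y m) (\<lambda>m. y m + t * x m) (\<lambda>m. z m + t * w m)"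
  by (simp add: fun_eq_iff deform_def surf_def)

text \<open>The top view of the deformed surface is the image of \<open>(x, y)\<close> under \<open>1 + t J\<close>, where \<open>J\<close> is the
rotation by a right angle. This matrix has determinant \<open>1 + t\<^sup>2\<close>, and the slopes of the deformed
surface are obtained from \<open>(p + t a, q + t b)\<close> by the matrix \<open>(1 + t J) / (1 + t\<^sup>2)\<close>; the factor
\<open>r\<close> is \<open>1 / (1 + t\<^sup>2)\<close> in the application.\<close>

lemma
  assumes m: "m \<in> U"
  shows jac_deform_top: "jac (\<lambda>m. x m - t * y m) (\<lambda>m. y m + t * x m) m = (1 + t\<^sup>2) * jac x y m"
    and jac_deform_slopes: "jac (\<lambda>m. r * ((p m + t * a m) - t * (q m + t * b m)))
        (\<lambda>m. r * ((q m + t * b m) + t * (p m + t * a m))) m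
      = r\<^sup>2 * (1 + t\<^sup>2) * (jac p q m + t * (jac p b m + jac a q m) + t\<^sup>2 * jac a b m)"
  unfolding jac_def
  by (simp_all add: partials_add partials_diff partials_mult partials_const diff_all[OF m] power2_eq_square algebra_simps)

lemma contact_surface_deform:
  "contact_surface U (\<lambda>m. x m - t * y m) (\<lambda>m. y m + t * x m) (\<lambda>m. z m + t * w m)
     (\<lambda>m. inverse (1 + t\<^sup>2) * ((p m + t * a m) - t * (q m + t * b m)))
     (\<lambda>m. inverse (1 + t\<^sup>2) * ((q m + t * b m) + t * (p m + t * a m)))"
proof
  show "jac (\<lambda>m. x m - t * y m) (\<lambda>m. y m + t * x m) m \<noteq> 0" if "m \<in> U" for m
    using immersed[OF that] by (simp add: jac_deform_top[OF that] add_nonneg_eq_0_iff)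
  have t: "1 + t\<^sup>2 \<noteq> 0" by (simp add: add_nonneg_eq_0_iff)
  have rot: "P * X + Q * Y = (inverse (1 + t\<^sup>2) * (P - t * Q)) * (X - t * Y) + (inverse (1 + t\<^sup>2) * (Q + t * P)) * (Y + t * X)"
    for P Q X Y
  proof -
    have "(P - t * Q) * (X - t * Y) + (Q + t * P) * (Y + t * X) = (1 + t\<^sup>2) * (P * X + Q * Y)"
      by (simp add: power2_eq_square algebra_simps)
    then have "inverse (1 + t\<^sup>2) * ((P - t * Q) * (X - t * Y) + (Q + t * P) * (Y + t * X)) = P * X + Q * Y"
      using t by simp
    then show ?thesis by (simp add: algebra_simps)
  qed
  show "total_differential U (\<lambda>m. z m + t * w m)
     (\<lambda>m. inverse (1 + t\<^sup>2) * ((p m + t * a m) - t * (q m + t * b m))) (\<lambda>m. x m - t * y m)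
     (\<lambda>m. inverse (1 + t\<^sup>2) * ((q m + t * b m) + t * (p m + t * a m))) (\<lambda>m. y m + t * x m)"
    unfolding total_differential_def
  proof (intro ballI conjI)
    fix m assume m: "m \<in> U"
    note D = partials_add partials_diff partials_mult partials_const diff_all[OF m]
      total_differentialD[OF dz m] total_differentialD[OF dw m]
    show "Du (\<lambda>m. z m + t * w m) m
      = inverse (1 + t\<^sup>2) * ((p m + t * a m) - t * (q m + t * b m)) * Du (\<lambda>m. x m - t * y m) m
      + inverse (1 + t\<^sup>2) * ((q m + t * b m) + t * (p m + t * a m)) * Du (\<lambda>m. y m + t * x m) m"
      using rot[of "p m + t * a m" "Du x m" "q m + t * b m" "Du y m"] by (simp add: D) (simp add: algebra_simps)
    show "Dv (\<lambda>m. z m + t * w m) m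
      = inverse (1 + t\<^sup>2) * ((p m + t * a m) - t * (q m + t * b m)) * Dv (\<lambda>m. x m - t * y m) m
      + inverse (1 + t\<^sup>2) * ((q m + t * b m) + t * (p m + t * a m)) * Dv (\<lambda>m. y m + t * x m) m"
      using rot[of "p m + t * a m" "Dv x m" "q m + t * b m" "Dv y m"] by (simp add: D) (simp add: algebra_simps)
  qed
qed (intro open_U smooth smooth_all)+

lemma isotropic_K_deform:
  assumes m: "m \<in> U"
  shows "isotropic_K (deform (surf x y z) (surf (\<lambda>m. - y m) x w) t) m
    = (jac p q m + t * (jac p b m + jac a q m) + t\<^sup>2 * jac a b m) / ((1 + t\<^sup>2)\<^sup>2 * jac x y m)"
proof -
  have "1 + t\<^sup>2 \<noteq> 0" by (simp add: add_nonneg_eq_0_iff)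
  then show ?thesis
    unfolding deform_eq contact_surface.isotropic_K_surf[OF contact_surface_deform m]
      jac_deform_top[OF m] jac_deform_slopes[OF m]
    by (simp add: power2_eq_square divide_simps)
qed

lemma isotropic_K_deform_derivative:
  assumes m: "m \<in> U"
  shows "((\<lambda>t. isotropic_K (deform (surf x y z) (surf (\<lambda>m. - y m) x w) t) m)
    has_real_derivative (jac p b m + jac a q m) / jac x y m) (at 0)"
  unfolding isotropic_K_deform[OF m] using immersed[OF m]
  by (auto intro!: derivative_eq_intros simp: power2_eq_square)

lemma top_view_deform_partials:
  assumes m: "m \<in> U"
  shows "Du (top_view \<circ> deform (surf x y z) (surf (\<lambda>m. - y m) x w) t) m
      = (Du x m - t * Du y m, Du y m + t * Du x m)"
    "Dv (top_view \<circ> deform (surf x y z) (surf (\<lambda>m. - y m) x w) t) m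
      = (Dv x m - t * Dv y m, Dv y m + t * Dv x m)"
  unfolding deform_eq
  by (simp_all add: o_def surf_def partials_Pair partials_add partials_diff partials_mult partials_const diff_all[OF m])

text \<open>Up to the factor \<open>dx \<and> dy\<close>, the curvature of the deformed surface has the derivative
\<open>dp \<and> db + da \<and> dq = d(p db - q da)\<close> at time zero. So flexibility is the integrability condition for
the third coordinate of the rotation diagram.\<close>

lemma velocity_diagram_iff:
  "velocity_diagram U (surf x y z) (surf (\<lambda>m. - y m) x w) \<longleftrightarrow> (\<forall>m\<in>U. jac p b m + jac a q m = 0)"
proof
  assume *: "velocity_diagram U (surf x y z) (surf (\<lambda>m. - y m) x w)"
  show "\<forall>m\<in>U. jac p b m + jac a q m = 0"
  proof
    fix m assume m: "m \<in> U"
    have "(jac p b m + jac a q m) / jac x y m = 0"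
      by (rule DERIV_unique[OF isotropic_K_deform_derivative[OF m]])
        (use * m in \<open>simp add: velocity_diagram_def Let_def\<close>)
    then show "jac p b m + jac a q m = 0" using immersed[OF m] by simp
  qed
next
  assume *: "\<forall>m\<in>U. jac p b m + jac a q m = 0"
  \<comment> \<open>This is \<open>(1 + t\<^sup>2)\<close> times the inner product of \<open>(x1, y1)\<close> and \<open>(x2, y2)\<close>: the matrix \<open>1 + t J\<close>
    is a similarity.\<close>
  have rot: "((\<lambda>t. (x1 - t * y1) * (x2 - t * y2) + (y1 + t * x1) * (y2 + t * x2))
      has_real_derivative 0) (at 0)" for x1 y1 x2 y2 :: real
    by (auto intro!: derivative_eq_intros)
  show "velocity_diagram U (surf x y z) (surf (\<lambda>m. - y m) x w)"
    unfolding velocity_diagram_def Let_def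
  proof (intro conjI ballI)
    show "smooth_on U (surf (\<lambda>m. - y m) x w)"
      unfolding surf_def[abs_def] using open_U by (intro smooth smooth_all)
    fix m assume m: "m \<in> U"
    show "((\<lambda>t. isotropic_K (deform (surf x y z) (surf (\<lambda>m. - y m) x w) t) m) has_real_derivative 0) (at 0)"
      using isotropic_K_deform_derivative[OF m] * m by simp
  qed (simp_all add: admissible_surf top_view_deform_partials rot)
qed

end

section \<open>One step of the wreath\<close>

lemma velocity_diagram_uminus:
  assumes "velocity_diagram U X Y"
  shows "velocity_diagram U X (\<lambda>m. - Y m)"
proof -
  have 1: "deform X (\<lambda>m. - Y m) t = deform X Y (- t)" for t
    by (simp add: fun_eq_iff deform_def)
  have d: "(uminus has_real_derivative - 1) (at (0::real))"
    by (auto intro!: derivative_eq_intros)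
  have 2: "((\<lambda>t. \<psi> (- t)) has_real_derivative 0) (at 0)"
    if "(\<psi> has_real_derivative 0) (at 0)" for \<psi> :: "real \<Rightarrow> real"
    using DERIV_chain2[of \<psi> 0 uminus 0 "-1" UNIV] d that by simp
  have U: "open U" using assms by (simp add: velocity_diagram_def admissible_def)
  show ?thesis
    using assms unfolding velocity_diagram_def Let_def 1 by (auto intro!: 2 smooth_on_uminus[OF U])
qed

lemma duality_related_sym:
  assumes "duality_related U X Y"
  shows "duality_related U Y X"
proof -
  have "metric_duality (metric_duality e) = e" for e
    by (cases e) (simp add: algebra_simps)
  then have "metric_duality ` metric_duality ` E = E" for E
    by (simp add: image_image)
  then show ?thesis using assms by (metis duality_related_def)
qed

lemma coordinates_surf: "xc (surf x y z) = x" "yc (surf x y z) = y" "zc (surf x y z) = z"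
  by (simp_all add: fun_eq_iff xc_def yc_def zc_def surf_def)

locale flexible_pair = velocity_pair +
  assumes flexible: "m \<in> U \<Longrightarrow> jac p b m + jac a q m = 0"
begin

text \<open>Exchanging a surface with its velocity diagram. The old surface \<open>(x, y, z)\<close> is minus the rotation
of \<open>(-y, x)\<close> in top view, so the normalization of the velocity forces the sign of \<open>z\<close>.\<close>

lemma flexible_pair_reversed:
  "flexible_pair U (\<lambda>m. - y m) x w (\<lambda>m. - b m) a (\<lambda>m. - z m) q (\<lambda>m. - p m)"
proof
  show "jac (\<lambda>m. - y m) x m \<noteq> 0" if "m \<in> U" for m
    using immersed[OF that] diff_all[OF that] by (simp add: jac_def partials_uminus algebra_simps)
  show "total_differential U w (\<lambda>m. - b m) (\<lambda>m. - y m) a x"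
    "total_differential U (\<lambda>m. - z m) q (\<lambda>m. - y m) (\<lambda>m. - p m) x"
    using dz dw diff_all by (simp_all add: total_differential_def partials_uminus)
  show "jac (\<lambda>m. - b m) (\<lambda>m. - p m) m + jac q a m = 0" if "m \<in> U" for m
    using flexible[OF that] diff_all[OF that] by (simp add: jac_def partials_uminus algebra_simps)
qed (intro open_U smooth smooth_all)+

text \<open>Flexibility is symmetric in the two surfaces, up to reversing the time in the second case.\<close>

lemma velocity_diagrams:
  "velocity_diagram U (surf x y z) (surf (\<lambda>m. - y m) x w)"
  "velocity_diagram U (surf (\<lambda>m. - y m) x w) (surf x y z)"
proof -
  show "velocity_diagram U (surf x y z) (surf (\<lambda>m. - y m) x w)"
    using flexible velocity_diagram_iff by blast
  interpret V: flexible_pair U "\<lambda>m. - y m" x w "\<lambda>m. - b m" a "\<lambda>m. - z m" q "\<lambda>m. - p m"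
    by (rule flexible_pair_reversed)
  have "velocity_diagram U (surf (\<lambda>m. - y m) x w) (surf (\<lambda>m. - x m) (\<lambda>m. - y m) (\<lambda>m. - z m))"
    using V.flexible V.velocity_diagram_iff by blast
  note velocity_diagram_uminus[OF this]
  moreover have "(\<lambda>m. - surf (\<lambda>m. - x m) (\<lambda>m. - y m) (\<lambda>m. - z m) m) = surf x y z"
    by (simp add: fun_eq_iff surf_def)
  ultimately show "velocity_diagram U (surf (\<lambda>m. - y m) x w) (surf x y z)"
    by simp
qed

lemma I_orthogonal_surf: "I_orthogonal U (surf (\<lambda>m. - y m) x w) (surf x y z)"
  using diff_all
  by (simp add: I_orthogonal_def o_def surf_def partials_Pair partials_uminus algebra_simps)

lemma normalized_surf: "normalized_velocity_diagram U (surf x y z) (surf (\<lambda>m. - y m) x w)"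
  unfolding normalized_velocity_diagram_def coordinates_surf
  using velocity_diagrams(1) by (simp add: surf_def)

lemma differential_on_surf: "differential_on U w (surf x y z) a b"
  unfolding differential_on_def coordinates_surf
  using frechet_derivative_total_differential[OF dw] diff_all by blast

lemma translation_diagram_surf:
  "translation_diagram U (surf x y z) (surf (\<lambda>m. - y m) x w)
     (surf (\<lambda>m. - b m) a (\<lambda>m. a m * x m + b m * y m - w m))"
  unfolding translation_diagram_def coordinates_surf
  using normalized_surf differential_on_surf smooth_a smooth_b by (auto simp: surf_def)

end

text \<open>A flexible pair with a chosen third coordinate \<open>s\<close> of its rotation diagram. The last assumption says
that the rotation and the translation diagram have immersed top views.\<close>

locale wreath_pair = flexible_pair +
  fixes s :: "plane_point \<Rightarrow> real"
  assumes smooth_s: "smooth_on U s"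
    and ds: "total_differential U s (\<lambda>m. - q m) a p b"
    and slopes_immersed: "m \<in> U \<Longrightarrow> jac a b m \<noteq> 0"
begin

lemma diff_s: "m \<in> U \<Longrightarrow> s differentiable at m"
  using smooth_on_differentiable[OF smooth_s] .

lemma rotation_diagram_surf:
  "rotation_diagram U (surf x y z) (surf (\<lambda>m. - y m) x w) (surf (\<lambda>m. - a m) (\<lambda>m. - b m) s)"
  unfolding rotation_diagram_def coordinates_surf
proof (intro conjI exI ballI allI)
  fix m v assume m: "m \<in> U"
  show "(x m, y m, z m, p m, q m) \<in> contact_elements (surf x y z) m"
    by (simp add: contact_elements_surf[OF m])
  show "frechet_derivative s (at m) v
      = - q m * frechet_derivative a (at m) v + p m * frechet_derivative b (at m) v"
    by (rule frechet_derivative_total_differential[OF ds m diff_s[OF m] diff_all(7,8)[OF m]])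
qed (simp_all add: surf_def normalized_surf differential_on_surf smooth_a smooth_b smooth_s)

text \<open>The slopes of the translation diagram are \<open>(-y, x)\<close> and those of the rotation diagram over it are
\<open>(-p, -q)\<close>. Flexibility of the new pair is \<open>dp \<and> dx + dq \<and> dy = 0\<close>, which is \<open>ddz = 0\<close>.\<close>

lemma flexible_pair_next:
  "flexible_pair U (\<lambda>m. - b m) a (\<lambda>m. a m * x m + b m * y m - w m) (\<lambda>m. - y m) x s
     (\<lambda>m. - p m) (\<lambda>m. - q m)"
proof
  fix m assume m: "m \<in> U"
  show "jac (\<lambda>m. - b m) a m \<noteq> 0"
    using slopes_immersed[OF m] diff_all[OF m] by (simp add: jac_def partials_uminus algebra_simps)
  have "jac p x m + jac q y m = 0"
    by (rule total_differential_closed[OF open_U smooth_z smooth_p smooth_x smooth_q smooth_y dz m])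
  then show "jac (\<lambda>m. - y m) (\<lambda>m. - q m) m + jac (\<lambda>m. - p m) x m = 0"
    using diff_all[OF m] by (simp add: jac_def partials_uminus algebra_simps)
next
  show "total_differential U (\<lambda>m. a m * x m + b m * y m - w m) (\<lambda>m. - y m) (\<lambda>m. - b m) x a"
    unfolding total_differential_def using diff_all total_differentialD[OF dw]
    by (simp add: partials_add partials_diff partials_mult partials_uminus algebra_simps)
  show "total_differential U s (\<lambda>m. - p m) (\<lambda>m. - b m) (\<lambda>m. - q m) a"
    unfolding total_differential_def using diff_all total_differentialD[OF ds]
    by (simp add: partials_uminus algebra_simps)
qed (intro open_U smooth smooth_all smooth_s)+

text \<open>The third coordinate of the next rotation diagram must have the differential \<open>x dp + y dq\<close>, which is
that of the Legendre transform \<open>p x + q y - z\<close>. With this choice of the constants of integration, the data after three steps are the initial ones. The assumption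
is the immersion condition of the new pair, since its velocity slopes are \<open>(-p, -q)\<close>.\<close>

lemma wreath_pair_next:
  assumes "\<And>m. m \<in> U \<Longrightarrow> jac p q m \<noteq> 0"
  shows "wreath_pair U (\<lambda>m. - b m) a (\<lambda>m. a m * x m + b m * y m - w m) (\<lambda>m. - y m) x s
     (\<lambda>m. - p m) (\<lambda>m. - q m) (\<lambda>m. p m * x m + q m * y m - z m)"
  unfolding wreath_pair_def
proof (intro conjI flexible_pair_next, unfold_locales)
  show "smooth_on U (\<lambda>m. p m * x m + q m * y m - z m)"
    by (intro open_U smooth smooth_all)
  show "total_differential U (\<lambda>m. p m * x m + q m * y m - z m) (\<lambda>m. - x m) (\<lambda>m. - p m) (\<lambda>m. - y m) (\<lambda>m. - q m)"
    unfolding total_differential_def using diff_all total_differentialD[OF dz]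
    by (simp add: partials_add partials_diff partials_mult partials_uminus algebra_simps)
  show "jac (\<lambda>m. - p m) (\<lambda>m. - q m) m \<noteq> 0" if "m \<in> U" for m
    using assms[OF that] diff_all[OF that] by (simp add: jac_def partials_uminus)
qed

lemma wreath_step_surf:
  "wreath_step U (surf x y z, surf (\<lambda>m. - y m) x w)
     (surf (\<lambda>m. - b m) a (\<lambda>m. a m * x m + b m * y m - w m), surf (\<lambda>m. - a m) (\<lambda>m. - b m) s)"
  unfolding wreath_step_def fst_conv snd_conv
  using translation_diagram_surf rotation_diagram_surf by blast

text \<open>The contact elements of the velocity diagram are \<open>(-y, x, w, -b, a)\<close>, and those of the translation
diagram are \<open>(-b, a, a x + b y - w, -y, x)\<close>.\<close>

lemma duality_related_surf:
  "duality_related U (surf (\<lambda>m. - y m) x w)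
     (surf (\<lambda>m. - b m) a (\<lambda>m. a m * x m + b m * y m - w m))"
proof -
  interpret V: flexible_pair U "\<lambda>m. - y m" x w "\<lambda>m. - b m" a "\<lambda>m. - z m" q "\<lambda>m. - p m"
    by (rule flexible_pair_reversed)
  interpret T: flexible_pair U "\<lambda>m. - b m" a "\<lambda>m. a m * x m + b m * y m - w m" "\<lambda>m. - y m" x s
    "\<lambda>m. - p m" "\<lambda>m. - q m"
    by (rule flexible_pair_next)
  show ?thesis
    by (simp add: duality_related_def V.admissible_surf T.admissible_surf
        V.contact_elements_surf T.contact_elements_surf)
qed

text \<open>After the rotation, the rotation diagram becomes \<open>(b, -a, s)\<close>, and \<open>ds = p db + q d(-a)\<close> says that its
slopes are again \<open>p\<close> and \<open>q\<close>.\<close>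

lemma parallel_tangent_planes_surf:
  "parallel_tangent_planes U (surf x y z) (rot90 \<circ> surf (\<lambda>m. - a m) (\<lambda>m. - b m) s)"
proof -
  interpret R: contact_surface U b "\<lambda>m. - a m" s p q
  proof
    show "jac b (\<lambda>m. - a m) m \<noteq> 0" if "m \<in> U" for m
      using slopes_immersed[OF that] diff_all[OF that] by (simp add: jac_def partials_uminus algebra_simps)
    show "total_differential U s p b q (\<lambda>m. - a m)"
      unfolding total_differential_def using diff_all total_differentialD[OF ds]
      by (simp add: partials_uminus)
  qed (intro open_U smooth smooth_all smooth_s)+
  have "rot90 \<circ> surf (\<lambda>m. - a m) (\<lambda>m. - b m) s = surf b (\<lambda>m. - a m) s"
    by (simp add: fun_eq_iff surf_def)
  then show ?thesis
    by (simp add: parallel_tangent_planes_def admissible_surf R.admissible_surf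
        tangent_space_surf R.tangent_space_surf)
qed

end

section \<open>The Darboux wreath\<close>

theorem theorem50:
  fixes U :: "(real \<times> real) set" and f n c :: "real \<times> real \<Rightarrow> real"
    and F V C Cbar B Bbar :: surface
  defines "F \<equiv> \<lambda>(u, v). (u, v, f (u, v))"
    and "V \<equiv> \<lambda>(u, v). (- v, u, n (u, v))"
    and "C \<equiv> \<lambda>(u, v). (- Du n (u, v), - Dv n (u, v), c (u, v))"
    and "Cbar \<equiv> \<lambda>(u, v). (- Dv n (u, v), Du n (u, v),
                  Du n (u, v) * u + Dv n (u, v) * v - n (u, v))"
    and "B \<equiv> \<lambda>(u, v). (Du f (u, v), Dv f (u, v),
                  Du f (u, v) * u + Dv f (u, v) * v - f (u, v))"
    and "Bbar \<equiv> \<lambda>(u, v). (Dv f (u, v), - Du f (u, v),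
                  - Du n (u, v) * Dv f (u, v) + Dv n (u, v) * Du f (u, v) - c (u, v))"
  assumes open_U: "open U"
    and smooth_f: "smooth_on U f"
    and smooth_n: "smooth_on U n"
    and flexible: "velocity_diagram U F V"
    and f_nondeg: "\<And>m. m \<in> U \<Longrightarrow> Du (Du f) m * Dv (Dv f) m - (Dv (Du f) m)\<^sup>2 \<noteq> 0"
    and n_nondeg: "\<And>m. m \<in> U \<Longrightarrow> Du (Du n) m * Dv (Dv n) m - (Dv (Du n) m)\<^sup>2 \<noteq> 0"
    and c_diff: "\<And>m. m \<in> U \<Longrightarrow> c differentiable at m"
    and c_u: "\<And>m. m \<in> U \<Longrightarrow> Du c m = Du f m * Dv (Du n) m - Dv f m * Du (Du n) m"
    and c_v: "\<And>m. m \<in> U \<Longrightarrow> Dv c m = Du f m * Dv (Dv n) m - Dv f m * Dv (Du n) m"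
  shows
    "(\<forall>m\<in>U. Du (Du f) m * Dv (Dv n) m - 2 * Dv (Du f) m * Dv (Du n) m
             + Dv (Dv f) m * Du (Du n) m = 0) \<and>
     \<comment> \<open>(i)\<close>
     rotation_diagram U F V C \<and> translation_diagram U F V Cbar \<and>
     velocity_diagram U C Cbar \<and> velocity_diagram U Cbar C \<and>
     \<comment> \<open>(ii)\<close>
     wreath_step U (F, V) (Cbar, C) \<and> wreath_step U (Cbar, C) (Bbar, B) \<and>
     wreath_step U (Bbar, B) (F, V) \<and> darboux_wreath U [(F, V), (Cbar, C), (Bbar, B)] \<and>
     \<comment> \<open>(iii)\<close>
     wreath_surfaces [(F, V), (Cbar, C), (Bbar, B)] = {F, V, C, Cbar, B, Bbar} \<and>
     (\<forall>X\<in>{F, V, C, Cbar, B, Bbar}. admissible U X) \<and>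
     \<comment> \<open>(iv)\<close>
     (\<forall>(X, Y)\<in>{(V, F), (C, Cbar), (B, Bbar)}.
        velocity_diagram U X Y \<and> velocity_diagram U Y X \<and> I_orthogonal U X Y) \<and>
     \<comment> \<open>(v)\<close>
     (\<forall>(X, Y)\<in>{(V, Cbar), (F, B), (C, Bbar)}. duality_related U X Y) \<and>
     \<comment> \<open>(vi)\<close>
     (\<forall>(X, Y)\<in>{(F, C), (Cbar, B), (Bbar, V)}. parallel_tangent_planes U X (rot90 \<circ> Y))"
proof -
  have smooth_partials: "smooth_on U (Du f)" "smooth_on U (Dv f)" "smooth_on U (Du n)" "smooth_on U (Dv n)"
    by (intro smooth smooth_f smooth_n)+
  note comm = mixed_partials_commute[OF open_U smooth_f] mixed_partials_commute[OF open_U smooth_n]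
  interpret FV: velocity_pair U fst snd f "Du f" "Dv f" n "Du n" "Dv n"
    by unfold_locales
      (simp_all add: open_U smooth_partials smooth_f smooth_n smooth_on_fst smooth_on_snd
        total_differential_def jac_def partials_fst_snd)
  have FV: "F = surf fst snd f" "V = surf (\<lambda>m. - snd m) fst n"
    by (simp_all add: F_def V_def fun_eq_iff surf_def)
  have flex: "jac (Du f) (Dv n) m + jac (Du n) (Dv f) m = 0" if "m \<in> U" for m
    using flexible FV.velocity_diagram_iff that unfolding FV by blast
  have smooth_c: "smooth_on U c"
    by (rule smooth_on_if_smooth_partials[OF open_U c_diff c_u c_v])
      (assumption | intro smooth smooth_f smooth_n open_U)+
  interpret P1: wreath_pair U fst snd f "Du f" "Dv f" n "Du n" "Dv n" c
  proof
    show "total_differential U c (\<lambda>m. - Dv f m) (Du n) (Du f) (Dv n)"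
      by (simp add: total_differential_def c_u c_v comm)
    show "jac (Du n) (Dv n) m \<noteq> 0" if "m \<in> U" for m
      using n_nondeg[OF that] that by (simp add: jac_def comm power2_eq_square)
  qed (use flex smooth_c in auto)
  have "jac (Du f) (Dv f) m \<noteq> 0" if "m \<in> U" for m
    using f_nondeg[OF that] that by (simp add: jac_def comm power2_eq_square)
  \<comment> \<open>The double negations below are kept as one step produces them, so that the facts of the three
    interpretations match; they disappear when the six surfaces are identified.\<close>
  note P2 = P1.wreath_pair_next[OF this]
  interpret P2: wreath_pair U "\<lambda>m. - Dv n m" "Du n" "\<lambda>m. Du n m * fst m + Dv n m * snd m - n m"
      "\<lambda>m. - snd m" fst c "\<lambda>m. - Du f m" "\<lambda>m. - Dv f m" "\<lambda>m. Du f m * fst m + Dv f m * snd m - f m"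
    by (rule P2)
  have "jac (\<lambda>m. - snd m) fst m \<noteq> 0" if "m \<in> U" for m
    using FV.diff_all[OF that] by (simp add: jac_def partials_uminus partials_fst_snd)
  note P3 = P2.wreath_pair_next[OF this]
  interpret P3: wreath_pair U "\<lambda>m. - (- Dv f m)" "\<lambda>m. - Du f m"
      "\<lambda>m. - Du f m * (- Dv n m) + - Dv f m * Du n m - c m" "\<lambda>m. - Du n m" "\<lambda>m. - Dv n m"
      "\<lambda>m. Du f m * fst m + Dv f m * snd m - f m" "\<lambda>m. - (- snd m)" "\<lambda>m. - fst m"
      "\<lambda>m. - snd m * (- Dv n m) + fst m * Du n m - (Du n m * fst m + Dv n m * snd m - n m)"
    by (rule P3)
  have E1: "Cbar = surf (\<lambda>m. - Dv n m) (Du n) (\<lambda>m. Du n m * fst m + Dv n m * snd m - n m)"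
    "C = surf (\<lambda>m. - Du n m) (\<lambda>m. - Dv n m) c"
    by (simp_all add: C_def Cbar_def fun_eq_iff surf_def)
  have E2: "Bbar = surf (\<lambda>m. - (- Dv f m)) (\<lambda>m. - Du f m)
      (\<lambda>m. - Du f m * (- Dv n m) + - Dv f m * Du n m - c m)"
    "B = surf (\<lambda>m. - (- Du f m)) (\<lambda>m. - (- Dv f m)) (\<lambda>m. Du f m * fst m + Dv f m * snd m - f m)"
    by (simp_all add: B_def Bbar_def fun_eq_iff surf_def)
  have E3: "F = surf (\<lambda>m. - (- fst m)) (\<lambda>m. - (- snd m))
      (\<lambda>m. - (- snd m) * (- (- Dv f m)) + - fst m * (- Du f m) - (Du f m * fst m + Dv f m * snd m - f m))"
    "V = surf (\<lambda>m. - (- (- snd m))) (\<lambda>m. - (- fst m)) 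
      (\<lambda>m. - snd m * (- Dv n m) + fst m * Du n m - (Du n m * fst m + Dv n m * snd m - n m))"
    by (simp_all add: F_def V_def fun_eq_iff surf_def)
  have step: "wreath_step U (F, V) (Cbar, C)" "wreath_step U (Cbar, C) (Bbar, B)" "wreath_step U (Bbar, B) (F, V)"
    using P1.wreath_step_surf P2.wreath_step_surf P3.wreath_step_surf
    unfolding FV[symmetric] E1[symmetric] E2[symmetric] E3[symmetric] .
  have vel: "velocity_diagram U F V" "velocity_diagram U V F" "velocity_diagram U Cbar C"
    "velocity_diagram U C Cbar" "velocity_diagram U Bbar B" "velocity_diagram U B Bbar"
    using P1.velocity_diagrams P2.velocity_diagrams P3.velocity_diagrams
    unfolding FV[symmetric] E1[symmetric] E2[symmetric] .
  have orth: "I_orthogonal U V F" "I_orthogonal U C Cbar" "I_orthogonal U B Bbar"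
    using P1.I_orthogonal_surf P2.I_orthogonal_surf P3.I_orthogonal_surf
    unfolding FV[symmetric] E1[symmetric] E2[symmetric] .
  have dual: "duality_related U V Cbar" "duality_related U C Bbar" "duality_related U B F"
    using P1.duality_related_surf P2.duality_related_surf P3.duality_related_surf
    unfolding FV[symmetric] E1[symmetric] E2[symmetric] E3[symmetric] .
  have par: "parallel_tangent_planes U F (rot90 \<circ> C)" "parallel_tangent_planes U Cbar (rot90 \<circ> B)"
    "parallel_tangent_planes U Bbar (rot90 \<circ> V)"
    using P1.parallel_tangent_planes_surf P2.parallel_tangent_planes_surf P3.parallel_tangent_planes_surf
    unfolding FV[symmetric] E1[symmetric] E2[symmetric] E3[symmetric] .
  have adm: "\<forall>X\<in>{F, V, C, Cbar, B, Bbar}. admissible U X"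
    using vel by (simp add: velocity_diagram_def)
  have pde: "Du (Du f) m * Dv (Dv n) m - 2 * Dv (Du f) m * Dv (Du n) m + Dv (Dv f) m * Du (Du n) m = 0"
    if "m \<in> U" for m
    using flex[OF that] that by (simp add: jac_def comm algebra_simps)
  have wreath: "darboux_wreath U [(F, V), (Cbar, C), (Bbar, B)]"
    unfolding darboux_wreath_def
  proof (intro conjI allI impI)
    fix i assume "i < length [(F, V), (Cbar, C), (Bbar, B)]"
    then have "i < 3" by simp
    then consider "i = 0" | "i = 1" | "i = 2" by linarith
    then show "wreath_step U ([(F, V), (Cbar, C), (Bbar, B)] ! i)
        ([(F, V), (Cbar, C), (Bbar, B)] ! (Suc i mod length [(F, V), (Cbar, C), (Bbar, B)]))"
      by cases (simp_all add: step)
  qed simp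
  have surfaces: "wreath_surfaces [(F, V), (Cbar, C), (Bbar, B)] = {F, V, C, Cbar, B, Bbar}"
    by (simp add: wreath_surfaces_def insert_commute)
  show ?thesis
    using pde step wreath surfaces vel orth dual duality_related_sym[OF dual(3)] par adm
    by (simp add: wreath_step_def)
qed

end
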